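(* Let $M$ be a smooth compact $d$-manifold embedded in $\mathbb{R}^N$, and let $\mathcal{A}=\{(U_i,E_i,D_i)\}_{i\in I}$ be a $C^1$ approximate autoencoder atlas on $M$ (with pointwise reconstruction error bounded by $\varepsilon$). Fix an ordered triple $(i,j,k)$ with $U_i\cap U_j\cap U_k\ne\emptyset$. Suppose there are constants $L_E=L_E^{(ijk)}$, $L_E'=(L_E')^{(ijk)}$, $L_D=L_D^{(ijk)}$, $L_D'=(L_D')^{(ijk)}$ such that the per-triple bounds hold: (i) $\|d(E_\ell)_p\|_{\mathrm{op}}\le L_E$ for $\ell\in\{j,k\}$ and all $p\in O_\ell$; (ii) $\|d(E_\ell)_p-d(E_\ell)_q\|_{\mathrm{op}}\le L_E'\|p-q\|$ for $\ell\in\{j,k\}$ and all $p,q\in O_\ell$; (iii) $\|d(D_\ell)_z\|_{\mathrm{op}}\le L_D$ for $\ell\in\{i,j\}$ and all $z\in E_\ell(O_\ell)$; (iv) $\|d(D_\ell)_z-d(D_\ell)_{z'}\|_{\mathrm{op}}\le L_D'\|z-z'\|$ for $\ell\in\{i,j\}$ and all $z,z'\in E_\ell(O_\ell)$; (v) $\varepsilon<\tau(M)$; and that the enlarged-neighbourhood condition (5) in the definition of approximate autoencoder atlas holds with $R=L_EL_D+3$. Put $$\delta^{(ijk)}:=\min\Bigl(\inf_{x\in U_i\cap U_j}|\det g_{ji}(x)|,\ \inf_{x\in U_i\cap U_k}|\det g_{ki}(x)|,\ \inf_{x\in U_j\cap U_k}|\det g_{kj}(x)|\Bigr),$$ $$\eta^{(ijk)}:=\max(\eta_i,\eta_j),\qquad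 \eta_\ell:=\sup_{x\in U_\ell}\bigl\|d(D_\ell\circ E_\ell)_x|_{T_xM}-\mathrm{Id}_{T_xM}\bigr\|_{\mathrm{op}},$$ $$\eta_{\mathrm{eff}}^{(ijk)}:=\frac{(L_EL_D+2)\,\eta^{(ijk)}}{1-\eta^{(ijk)}}+(L_D'L_E^2+L_DL_E')\,\varepsilon,$$ $$\Gamma^{(ijk)}:=L_E\,\eta_{\mathrm{eff}}^{(ijk)}\,L_D+L_E'\,(L_EL_D+2)\,\varepsilon\,(1+\eta_{\mathrm{eff}}^{(ijk)})\,L_D,$$ $$K_{\det}^{(ijk)}:=d\,C_g\,\varepsilon\,(L_EL_D+C_g\,\varepsilon)^{d-1},\qquad C_g:=L_E(L_EL_D'+L_E'L_D^2).$$ Suppose $\delta^{(ijk)}>0$ and $$\eta^{(ijk)}<1\qquad\text{and}\qquad\max\Bigl(d\,\Gamma^{(ijk)}\,(L_EL_D+\Gamma^{(ijk)})^{d-1},\;K_{\det}^{(ijk)}\Bigr)<\delta^{(ijk)}.\qquad(\ast)$$ Then, with $\omega_{ba}(x):=\operatorname{sign}(\det g_{ba}(x))$, $$\omega_{ki}(x)=\omega_{kj}(x)\cdot\omega_{ji}(x)\qquad\text{for all }x\in U_i\cap U_j\cap U_k.$$ In particular, fix a total order on $I$ and define a Čech $1$-cochain by $\omega^{\check C}_{\alpha\beta}:=\omega_{\beta\alpha}$ for $\alpha<\beta$. Suppose that for every ordered triple $(\alpha,\beta,\gamma)$ with $\alpha<\beta<\gamma$ and $U_\alpha\cap U_\beta\cap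 U_\gamma\ne\emptyset$ there are constants $L_E^{(\alpha\beta\gamma)}$, $(L_E')^{(\alpha\beta\gamma)}$, $L_D^{(\alpha\beta\gamma)}$, $(L_D')^{(\alpha\beta\gamma)}$ such that, taking $(i,j,k)=(\alpha,\beta,\gamma)$, the per-triple bounds (i)–(v) hold, the enlarged-neighbourhood condition (5) in the definition of approximate autoencoder atlas holds with $R=L_E^{(\alpha\beta\gamma)}L_D^{(\alpha\beta\gamma)}+3$, and $\delta^{(\alpha\beta\gamma)}>0$, $\eta^{(\alpha\beta\gamma)}<1$ and $$\max\Bigl(d\,\Gamma^{(\alpha\beta\gamma)}\,(L_E^{(\alpha\beta\gamma)}L_D^{(\alpha\beta\gamma)}+\Gamma^{(\alpha\beta\gamma)})^{d-1},\;K_{\det}^{(\alpha\beta\gamma)}\Bigr)<\delta^{(\alpha\beta\gamma)}.$$ Then $\{\omega^{\check C}_{\alpha\beta}\}$ is a Čech $1$-cocycle and defines a class $[\omega]\in\check H^1(\mathcal{U};\mathbb{Z}/2)$, where $\mathcal{U}=\{U_i\}_{i\in I}$.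
   Context: Manifolds are without boundary. All vector norms are Euclidean; $\|\cdot\|_{\mathrm{op}}$ is the operator norm. The reach $\tau(M)$ is the supremum of $r>0$ such that every point of $\{p\in\mathbb{R}^N:\operatorname{dist}(p,M)<r\}$ has a unique nearest point on $M$. An $(\varepsilon,\eta)$-approximate autoencoder atlas on a smooth $d$-manifold $M\subset\mathbb{R}^N$ is a collection $\{(U_i,E_i,D_i)\}_{i\in I}$ ($I$ finite) where: (1) $\{U_i\}$ is an open cover of $M$; (2) each encoder $E_i$ is a $C^1$ map defined on an open neighbourhood $O_i\supset U_i$ in $\mathbb{R}^N$ with values in $\mathbb{R}^d$, and each decoder $D_i:\tilde Z_i\to\mathbb{R}^N$ is a $C^1$ map on an open set $\tilde Z_i\subset\mathbb{R}^d$ with $\tilde Z_i\supset E_i(O_i)$; (3) $\sup_{x\in U_i}\|D_i(E_i(x))-x\|\le\varepsilon$ for every $i$; (4) $\sup_{x\in U_i}\|d(D_i\circ E_i)_x|_{T_xM}-\mathrm{Id}_{T_xM}\|_{\mathrm{op}}\le\eta$ for every $i$, both maps being viewed as maps $T_xM\to\mathbb{R}^N$; (5) there is a constant $R\ge1$ such that the open neighbourhoods $O_i$ contain the closed enlarged neighbourhoods $\{p\in\mathbb{R}^N:\operatorname{dist}(p,U_i)\le R\varepsilon\}$. A $C^1$ approximate autoencoder atlas is such a collection for some $\varepsilon,\eta$ (here $\eta$ is not assumed small). Transition maps are $T_{ji}=E_j\circ D_i$; for $x\in U_i\cap U_j$, $g_{ji}(x):=d(T_{ji})_{E_i(x)}\in\mathbb{R}^{d\times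 d}$. $\mathbb{Z}/2$ is identified with $\{\pm1\}$. A Čech $1$-cocycle of $\mathcal{U}$ is a family of locally constant functions $c_{\alpha\beta}:U_\alpha\cap U_\beta\to\{\pm1\}$ ($\alpha<\beta$, nonempty overlap) with $c_{\alpha\gamma}=c_{\alpha\beta}c_{\beta\gamma}$ on nonempty triple intersections, $\alpha<\beta<\gamma$; it is a coboundary if $c_{\alpha\beta}=\nu_\alpha\nu_\beta$ for locally constant $\nu_\alpha:U_\alpha\to\{\pm1\}$; $\check H^1(\mathcal{U};\mathbb{Z}/2)$ is cocycles modulo coboundaries. $\mathcal{A}$ is assumed to have nonvanishing determinants $\det g_{ji}$ on overlaps, uniformly bounded away from zero, whenever the signs $\omega_{ji}$ are regarded as a cochain. *)

theory Defs
  imports "HOL-Analysis.Analysis" "HOL-Algebra.Coset"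
begin

section \<open>Differentiability classes\<close>

text \<open>In finite dimension, \<open>f\<close> is of class \<open>C\<^sup>k\<close> on an open set iff it is differentiable there and
  all its directional derivatives are of class \<open>C\<^sup>k\<^sup>-\<^sup>1\<close>. The definition is meant for open sets only.\<close>

primrec Ck_on :: "nat \<Rightarrow> ('a::euclidean_space \<Rightarrow> 'b::euclidean_space) \<Rightarrow> 'a set \<Rightarrow> bool" where
  "Ck_on 0 f S \<longleftrightarrow> continuous_on S f"
| "Ck_on (Suc k) f S \<longleftrightarrow> (\<forall>x\<in>S. f differentiable (at x)) \<and>
     (\<forall>v. Ck_on k (\<lambda>x. frechet_derivative f (at x) v) S)"

definition smooth_on :: "('a::euclidean_space \<Rightarrow> 'b::euclidean_space) \<Rightarrow> 'a set \<Rightarrow> bool" where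
  "smooth_on f S \<longleftrightarrow> (\<forall>k. Ck_on k f S)"


section \<open>Embedded submanifolds, tangent spaces, reach\<close>

text \<open>A smooth submanifold without boundary, of dimension \<open>CARD('d)\<close>: every point has a
  neighbourhood in \<open>M\<close> that is the image of a regular smooth parametrisation which is a
  homeomorphism onto it.\<close>

definition smooth_submanifold :: "'d::finite itself \<Rightarrow> (real^'n) set \<Rightarrow> bool" where
  "smooth_submanifold _ M \<longleftrightarrow>
     (\<forall>p\<in>M. \<exists>V W (\<phi> :: real^'d \<Rightarrow> real^'n) \<psi>.
        open V \<and> p \<in> V \<and> open W \<and> smooth_on \<phi> W \<and>
        (\<forall>u\<in>W. inj (frechet_derivative \<phi> (at u))) \<and>
        homeomorphism W (M \<inter> V) \<phi> \<psi>)"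

text \<open>Velocities at \<open>x\<close> of smooth curves in \<open>M\<close>.\<close>

definition tangent_space :: "(real^'n) set \<Rightarrow> real^'n \<Rightarrow> (real^'n) set" where
  "tangent_space M x =
     {v. \<exists>\<gamma> e. e > 0 \<and> smooth_on \<gamma> {-e<..<e} \<and> \<gamma> ` {-e<..<e} \<subseteq> M \<and> \<gamma> 0 = x \<and>
           (\<gamma> has_vector_derivative v) (at 0)}"

text \<open>The reach may be infinite, hence the extended reals.\<close>

definition reach :: "(real^'n) set \<Rightarrow> ereal" where
  "reach M = Sup {ereal r | r. r > 0 \<and>
     (\<forall>p. infdist p M < r \<longrightarrow> (\<exists>!q. q \<in> M \<and> dist p q = infdist p M))}"

text \<open>Operator norm of the restriction of \<open>f\<close> to a subspace \<open>T\<close>; \<open>onorm_on UNIV\<close> is \<^const>\<open>onorm\<close>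
  (the quotient at the zero vector is \<open>0 / 0 = 0\<close>).\<close>

definition onorm_on ::
    "'a::real_normed_vector set \<Rightarrow> ('a \<Rightarrow> 'b::real_normed_vector) \<Rightarrow> real" where
  "onorm_on T f = (SUP v\<in>T. norm (f v) / norm v)"

lemma onorm_on_UNIV: "onorm_on UNIV f = onorm f"
  by (simp add: onorm_on_def onorm_def)


section \<open>Approximate autoencoder atlases\<close>

text \<open>The fields are \<open>U\<^sub>i\<close>, \<open>O\<^sub>i\<close>, \<open>E\<^sub>i\<close>, the open domain of \<open>D\<^sub>i\<close>, and \<open>D\<^sub>i\<close>. The maps are total
  functions whose values outside \<open>O\<^sub>i\<close> and the latent domain are irrelevant; since these sets are
  open, Frechet derivatives at their points do not depend on those values.\<close>

record ('n::finite, 'd::finite) ae_chart =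
  patch :: "(real^'n) set"
  nbhd :: "(real^'n) set"
  enc :: "real^'n \<Rightarrow> real^'d"
  latent :: "(real^'d) set"
  dec :: "real^'d \<Rightarrow> real^'n"

definition tangent_defect ::
    "(real^'n) set \<Rightarrow> ('n::finite, 'd::finite) ae_chart \<Rightarrow> real^'n \<Rightarrow> real" where
  "tangent_defect M a x =
     onorm_on (tangent_space M x) (\<lambda>v. frechet_derivative (dec a \<circ> enc a) (at x) v - v)"

text \<open>The guard is needed because \<^const>\<open>infdist\<close> to the empty set is \<open>0\<close> by convention, whereas
  the enlarged neighbourhood of an empty patch is empty.\<close>

definition enlarged_nbhds ::
    "'i set \<Rightarrow> ('i \<Rightarrow> ('n::finite, 'd::finite) ae_chart) \<Rightarrow> real \<Rightarrow> real \<Rightarrow> bool" where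
  "enlarged_nbhds I A \<epsilon> R \<longleftrightarrow>
     (\<forall>i\<in>I. {p. patch (A i) \<noteq> {} \<and> infdist p (patch (A i)) \<le> R * \<epsilon>} \<subseteq> nbhd (A i))"

definition approx_ae_atlas ::
    "(real^'n) set \<Rightarrow> 'i set \<Rightarrow> ('i \<Rightarrow> ('n::finite, 'd::finite) ae_chart) \<Rightarrow> real \<Rightarrow> real \<Rightarrow> bool" where
  "approx_ae_atlas M I A \<epsilon> \<eta> \<longleftrightarrow>
     finite I \<and>
     (\<forall>i\<in>I. openin (top_of_set M) (patch (A i))) \<and> (\<Union>i\<in>I. patch (A i)) = M \<and>
     (\<forall>i\<in>I. open (nbhd (A i)) \<and> patch (A i) \<subseteq> nbhd (A i) \<and> Ck_on 1 (enc (A i)) (nbhd (A i)) \<and>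
        open (latent (A i)) \<and> enc (A i) ` nbhd (A i) \<subseteq> latent (A i) \<and>
        Ck_on 1 (dec (A i)) (latent (A i))) \<and>
     (\<forall>i\<in>I. \<forall>x\<in>patch (A i). norm (dec (A i) (enc (A i) x) - x) \<le> \<epsilon>) \<and>
     (\<forall>i\<in>I. \<forall>x\<in>patch (A i). tangent_defect M (A i) x \<le> \<eta>) \<and>
     (\<exists>R\<ge>1. enlarged_nbhds I A \<epsilon> R)"

definition transition ::
    "('i \<Rightarrow> ('n::finite, 'd::finite) ae_chart) \<Rightarrow> 'i \<Rightarrow> 'i \<Rightarrow> real^'d \<Rightarrow> real^'d" where
  "transition A j i = enc (A j) \<circ> dec (A i)"

definition trans_jac ::
    "('i \<Rightarrow> ('n::finite, 'd::finite) ae_chart) \<Rightarrow> 'i \<Rightarrow> 'i \<Rightarrow> real^'n \<Rightarrow> real^'d^'d" where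
  "trans_jac A j i x = jacobian (transition A j i) (at (enc (A i) x))"

definition omega ::
    "('i \<Rightarrow> ('n::finite, 'd::finite) ae_chart) \<Rightarrow> 'i \<Rightarrow> 'i \<Rightarrow> real^'n \<Rightarrow> real" where
  "omega A b a x = sgn (det (trans_jac A b a x))"


section \<open>Hypotheses and constants attached to an ordered triple\<close>

definition triple_bounds ::
    "(real^'n) set \<Rightarrow> ('i \<Rightarrow> ('n::finite, 'd::finite) ae_chart) \<Rightarrow> real \<Rightarrow> 'i \<Rightarrow> 'i \<Rightarrow> 'i \<Rightarrow>
     real \<Rightarrow> real \<Rightarrow> real \<Rightarrow> real \<Rightarrow> bool" where
  "triple_bounds M A \<epsilon> i j k L\<^sub>E L\<^sub>E' L\<^sub>D L\<^sub>D' \<longleftrightarrow>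
     (\<forall>l\<in>{j,k}. \<forall>p\<in>nbhd (A l). onorm (frechet_derivative (enc (A l)) (at p)) \<le> L\<^sub>E) \<and>
     (\<forall>l\<in>{j,k}. \<forall>p\<in>nbhd (A l). \<forall>q\<in>nbhd (A l).
        onorm (\<lambda>v. frechet_derivative (enc (A l)) (at p) v - frechet_derivative (enc (A l)) (at q) v)
          \<le> L\<^sub>E' * norm (p - q)) \<and>
     (\<forall>l\<in>{i,j}. \<forall>z\<in>enc (A l) ` nbhd (A l). onorm (frechet_derivative (dec (A l)) (at z)) \<le> L\<^sub>D) \<and>
     (\<forall>l\<in>{i,j}. \<forall>z\<in>enc (A l) ` nbhd (A l). \<forall>z'\<in>enc (A l) ` nbhd (A l).
        onorm (\<lambda>v. frechet_derivative (dec (A l)) (at z) v - frechet_derivative (dec (A l)) (at z') v)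
          \<le> L\<^sub>D' * norm (z - z')) \<and>
     ereal \<epsilon> < reach M"

definition delta3 ::
    "('i \<Rightarrow> ('n::finite, 'd::finite) ae_chart) \<Rightarrow> 'i \<Rightarrow> 'i \<Rightarrow> 'i \<Rightarrow> real" where
  "delta3 A i j k = Min {
     (INF x \<in> patch (A i) \<inter> patch (A j). \<bar>det (trans_jac A j i x)\<bar>),
     (INF x \<in> patch (A i) \<inter> patch (A k). \<bar>det (trans_jac A k i x)\<bar>),
     (INF x \<in> patch (A j) \<inter> patch (A k). \<bar>det (trans_jac A k j x)\<bar>)}"

definition eta1 :: "(real^'n) set \<Rightarrow> ('n::finite, 'd::finite) ae_chart \<Rightarrow> real" where
  "eta1 M a = (SUP x\<in>patch a. tangent_defect M a x)"

definition eta3 ::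
    "(real^'n) set \<Rightarrow> ('i \<Rightarrow> ('n::finite, 'd::finite) ae_chart) \<Rightarrow> 'i \<Rightarrow> 'i \<Rightarrow> 'i \<Rightarrow> real" where
  "eta3 M A i j k = max (eta1 M (A i)) (eta1 M (A j))"

definition eta_eff :: "real \<Rightarrow> real \<Rightarrow> real \<Rightarrow> real \<Rightarrow> real \<Rightarrow> real \<Rightarrow> real" where
  "eta_eff L\<^sub>E L\<^sub>E' L\<^sub>D L\<^sub>D' \<epsilon> \<eta> =
     (L\<^sub>E * L\<^sub>D + 2) * \<eta> / (1 - \<eta>) + (L\<^sub>D' * L\<^sub>E^2 + L\<^sub>D * L\<^sub>E') * \<epsilon>"

definition Gamma3 :: "real \<Rightarrow> real \<Rightarrow> real \<Rightarrow> real \<Rightarrow> real \<Rightarrow> real \<Rightarrow> real" where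
  "Gamma3 L\<^sub>E L\<^sub>E' L\<^sub>D L\<^sub>D' \<epsilon> \<eta> =
     L\<^sub>E * eta_eff L\<^sub>E L\<^sub>E' L\<^sub>D L\<^sub>D' \<epsilon> \<eta> * L\<^sub>D +
     L\<^sub>E' * (L\<^sub>E * L\<^sub>D + 2) * \<epsilon> * (1 + eta_eff L\<^sub>E L\<^sub>E' L\<^sub>D L\<^sub>D' \<epsilon> \<eta>) * L\<^sub>D"

definition C_g :: "real \<Rightarrow> real \<Rightarrow> real \<Rightarrow> real \<Rightarrow> real" where
  "C_g L\<^sub>E L\<^sub>E' L\<^sub>D L\<^sub>D' = L\<^sub>E * (L\<^sub>E * L\<^sub>D' + L\<^sub>E' * L\<^sub>D^2)"

definition K_det :: "nat \<Rightarrow> real \<Rightarrow> real \<Rightarrow> real \<Rightarrow> real \<Rightarrow> real \<Rightarrow> real" where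
  "K_det d L\<^sub>E L\<^sub>E' L\<^sub>D L\<^sub>D' \<epsilon> =
     real d * C_g L\<^sub>E L\<^sub>E' L\<^sub>D L\<^sub>D' * \<epsilon> * (L\<^sub>E * L\<^sub>D + C_g L\<^sub>E L\<^sub>E' L\<^sub>D L\<^sub>D' * \<epsilon>) ^ (d - 1)"

definition triple_small ::
    "(real^'n) set \<Rightarrow> ('i \<Rightarrow> ('n::finite, 'd::finite) ae_chart) \<Rightarrow> real \<Rightarrow> 'i \<Rightarrow> 'i \<Rightarrow> 'i \<Rightarrow>
     real \<Rightarrow> real \<Rightarrow> real \<Rightarrow> real \<Rightarrow> bool" where
  "triple_small M A \<epsilon> i j k L\<^sub>E L\<^sub>E' L\<^sub>D L\<^sub>D' \<longleftrightarrow>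
     (let \<eta> = eta3 M A i j k; \<Gamma> = Gamma3 L\<^sub>E L\<^sub>E' L\<^sub>D L\<^sub>D' \<epsilon> \<eta>; d = CARD('d) in
       delta3 A i j k > 0 \<and> \<eta> < 1 \<and>
       max (real d * \<Gamma> * (L\<^sub>E * L\<^sub>D + \<Gamma>) ^ (d - 1)) (K_det d L\<^sub>E L\<^sub>E' L\<^sub>D L\<^sub>D' \<epsilon>) < delta3 A i j k)"


section \<open>Cech cohomology in degree one with coefficients in \<open>{1, -1}\<close>\<close>

definition locally_constant_on :: "'a::topological_space set \<Rightarrow> ('a \<Rightarrow> 'b) \<Rightarrow> bool" where
  "locally_constant_on S f \<longleftrightarrow>
     (\<forall>x\<in>S. \<exists>V. openin (top_of_set S) V \<and> x \<in> V \<and> f constant_on V)"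

definition sign_function_on :: "'a::topological_space set \<Rightarrow> ('a \<Rightarrow> real) \<Rightarrow> bool" where
  "sign_function_on S f \<longleftrightarrow> locally_constant_on S f \<and> f ` S \<subseteq> {1, -1}"

text \<open>\<open>r\<close> is the (reflexive) total order on the index set \<open>I\<close>.\<close>

definition index_less :: "'i set \<Rightarrow> ('i \<times> 'i) set \<Rightarrow> 'i \<Rightarrow> 'i \<Rightarrow> bool" where
  "index_less I r \<alpha> \<beta> \<longleftrightarrow> \<alpha> \<in> I \<and> \<beta> \<in> I \<and> (\<alpha>, \<beta>) \<in> r \<and> \<alpha> \<noteq> \<beta>"

text \<open>A cochain is a total function \<open>c \<alpha> \<beta> x\<close>, of which only the values with \<open>\<alpha> < \<beta>\<close> and
  \<open>x \<in> U\<^sub>\<alpha> \<inter> U\<^sub>\<beta>\<close> are meaningful. To have each cochain represented by exactly one function, all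
  other values are set to the neutral element \<open>1\<close>.\<close>

definition cech_normalize ::
    "'i set \<Rightarrow> ('i \<times> 'i) set \<Rightarrow> ('i \<Rightarrow> 'a set) \<Rightarrow> ('i \<Rightarrow> 'i \<Rightarrow> 'a \<Rightarrow> real) \<Rightarrow> 'i \<Rightarrow> 'i \<Rightarrow> 'a \<Rightarrow> real" where
  "cech_normalize I r U c =
     (\<lambda>\<alpha> \<beta> x. if index_less I r \<alpha> \<beta> \<and> x \<in> U \<alpha> \<inter> U \<beta> then c \<alpha> \<beta> x else 1)"

definition cech_cocycles ::
    "'i set \<Rightarrow> ('i \<times> 'i) set \<Rightarrow> ('i \<Rightarrow> 'a::topological_space set) \<Rightarrow> ('i \<Rightarrow> 'i \<Rightarrow> 'a \<Rightarrow> real) set" where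
  "cech_cocycles I r U =
     {c. cech_normalize I r U c = c \<and>
         (\<forall>\<alpha> \<beta>. index_less I r \<alpha> \<beta> \<longrightarrow> sign_function_on (U \<alpha> \<inter> U \<beta>) (c \<alpha> \<beta>)) \<and>
         (\<forall>\<alpha> \<beta> \<gamma>. index_less I r \<alpha> \<beta> \<longrightarrow> index_less I r \<beta> \<gamma> \<longrightarrow>
            (\<forall>x \<in> U \<alpha> \<inter> U \<beta> \<inter> U \<gamma>. c \<alpha> \<gamma> x = c \<alpha> \<beta> x * c \<beta> \<gamma> x))}"

definition cech_coboundaries ::
    "'i set \<Rightarrow> ('i \<times> 'i) set \<Rightarrow> ('i \<Rightarrow> 'a::topological_space set) \<Rightarrow> ('i \<Rightarrow> 'i \<Rightarrow> 'a \<Rightarrow> real) set" where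
  "cech_coboundaries I r U =
     {cech_normalize I r U (\<lambda>\<alpha> \<beta> x. \<nu> \<alpha> x * \<nu> \<beta> x) | \<nu>. \<forall>\<alpha>\<in>I. sign_function_on (U \<alpha>) (\<nu> \<alpha>)}"

definition cech_Z1 ::
    "'i set \<Rightarrow> ('i \<times> 'i) set \<Rightarrow> ('i \<Rightarrow> 'a::topological_space set) \<Rightarrow> ('i \<Rightarrow> 'i \<Rightarrow> 'a \<Rightarrow> real) monoid" where
  "cech_Z1 I r U =
     \<lparr>carrier = cech_cocycles I r U, mult = (\<lambda>b c \<alpha> \<beta> x. b \<alpha> \<beta> x * c \<alpha> \<beta> x), one = (\<lambda>_ _ _. 1)\<rparr>"

definition cech_H1 ::
    "'i set \<Rightarrow> ('i \<times> 'i) set \<Rightarrow> ('i \<Rightarrow> 'a::topological_space set) \<Rightarrow> ('i \<Rightarrow> 'i \<Rightarrow> 'a \<Rightarrow> real) set monoid" where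
  "cech_H1 I r U = cech_Z1 I r U Mod cech_coboundaries I r U"

definition cech_class ::
    "'i set \<Rightarrow> ('i \<times> 'i) set \<Rightarrow> ('i \<Rightarrow> 'a::topological_space set) \<Rightarrow> ('i \<Rightarrow> 'i \<Rightarrow> 'a \<Rightarrow> real) \<Rightarrow>
     ('i \<Rightarrow> 'i \<Rightarrow> 'a \<Rightarrow> real) set" where
  "cech_class I r U c = cech_coboundaries I r U #>\<^bsub>cech_Z1 I r U\<^esub> c"

lemma locally_constant_on_mult:
  fixes f g :: "'a::topological_space \<Rightarrow> real"
  assumes "locally_constant_on S f" "locally_constant_on S g"
  shows "locally_constant_on S (\<lambda>x. f x * g x)"
  unfolding locally_constant_on_def
proof
  fix x assume "x \<in> S"
  then obtain V W where V: "openin (top_of_set S) V" "x \<in> V" "f constant_on V"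
    and W: "openin (top_of_set S) W" "x \<in> W" "g constant_on W"
    using assms unfolding locally_constant_on_def by meson
  have "(\<lambda>x. f x * g x) constant_on (V \<inter> W)"
    using V(3) W(3) unfolding constant_on_def by (metis IntD1 IntD2)
  then show "\<exists>V. openin (top_of_set S) V \<and> x \<in> V \<and> (\<lambda>x. f x * g x) constant_on V"
    using V W by (intro exI[of _ "V \<inter> W"]) auto
qed

lemma sign_function_on_mult:
  "sign_function_on S f \<Longrightarrow> sign_function_on S g \<Longrightarrow> sign_function_on S (\<lambda>x. f x * g x)"
  unfolding sign_function_on_def
  by (intro conjI locally_constant_on_mult) (fastforce simp: image_subset_iff)+

lemma sign_function_on_one: "sign_function_on S (\<lambda>_. 1)"
  unfolding sign_function_on_def locally_constant_on_def constant_on_def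
  by (auto intro: exI[of _ S])

lemma sign_function_on_subset:
  assumes "sign_function_on S f" "T \<subseteq> S" shows "sign_function_on T f"
  unfolding sign_function_on_def locally_constant_on_def
proof (intro conjI ballI)
  show "f ` T \<subseteq> {1, -1}" using assms unfolding sign_function_on_def by auto
  fix x assume x: "x \<in> T"
  then obtain V where V: "openin (top_of_set S) V" "x \<in> V" "f constant_on V"
    using assms unfolding sign_function_on_def locally_constant_on_def by (meson subsetD)
  have "openin (top_of_set T) (T \<inter> V)"
    using V(1) assms(2) by (auto simp: openin_open)
  moreover have "f constant_on (T \<inter> V)"
    using V(3) unfolding constant_on_def by auto
  ultimately show "\<exists>V. openin (top_of_set T) V \<and> x \<in> V \<and> f constant_on V"
    using x V(2) by blast
qed

lemma sign_function_on_cong: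
  assumes "sign_function_on S f" "\<And>x. x \<in> S \<Longrightarrow> f x = g x" shows "sign_function_on S g"
  unfolding sign_function_on_def locally_constant_on_def
proof (intro conjI ballI)
  show "g ` S \<subseteq> {1, -1}" using assms unfolding sign_function_on_def by auto
  fix x assume x: "x \<in> S"
  then obtain V where V: "openin (top_of_set S) V" "x \<in> V" "f constant_on V"
    using assms unfolding sign_function_on_def locally_constant_on_def by meson
  moreover have "g constant_on V"
    using V(3) openin_imp_subset[OF V(1)] assms(2) unfolding constant_on_def by (metis subsetD)
  ultimately show "\<exists>V. openin (top_of_set S) V \<and> x \<in> V \<and> g constant_on V"
    by blast
qed

lemma cech_cocycle_square:
  assumes "c \<in> cech_cocycles I r U" shows "c \<alpha> \<beta> x * c \<alpha> \<beta> x = 1"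
proof (cases "index_less I r \<alpha> \<beta> \<and> x \<in> U \<alpha> \<inter> U \<beta>")
  case True
  then have "c \<alpha> \<beta> x \<in> {1, -1}"
    using assms unfolding cech_cocycles_def sign_function_on_def by blast
  then show ?thesis by auto
next
  case False
  have "cech_normalize I r U c \<alpha> \<beta> x = c \<alpha> \<beta> x"
    using assms unfolding cech_cocycles_def by auto
  then show ?thesis using False by (auto simp: cech_normalize_def split: if_splits)
qed

lemma cech_normalize_eq_iff:
  "cech_normalize I r U c = c \<longleftrightarrow>
     (\<forall>\<alpha> \<beta> x. \<not> (index_less I r \<alpha> \<beta> \<and> x \<in> U \<alpha> \<inter> U \<beta>) \<longrightarrow> c \<alpha> \<beta> x = 1)"
  unfolding cech_normalize_def fun_eq_iff by (auto split: if_splits)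

lemma cech_cocycles_mult:
  assumes "b \<in> cech_cocycles I r U" "c \<in> cech_cocycles I r U"
  shows "(\<lambda>\<alpha> \<beta> x. b \<alpha> \<beta> x * c \<alpha> \<beta> x) \<in> cech_cocycles I r U"
  using assms unfolding cech_cocycles_def cech_normalize_eq_iff
  by (auto intro: sign_function_on_mult)

lemma cech_cocycles_one: "(\<lambda>_ _ _. 1) \<in> cech_cocycles I r U"
  unfolding cech_cocycles_def cech_normalize_eq_iff by (auto intro: sign_function_on_one)

lemma comm_group_cech_Z1: "comm_group (cech_Z1 I r U)"
proof (rule comm_groupI)
  fix c assume "c \<in> carrier (cech_Z1 I r U)"
  then show "\<exists>b\<in>carrier (cech_Z1 I r U). b \<otimes>\<^bsub>cech_Z1 I r U\<^esub> c = \<one>\<^bsub>cech_Z1 I r U\<^esub>"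
    by (intro bexI[of _ c]) (auto simp: cech_Z1_def cech_cocycle_square)
qed (auto simp: cech_Z1_def cech_cocycles_mult cech_cocycles_one mult_ac)

lemma cech_coboundaries_subset:
  assumes "linear_order_on I r"
  shows "cech_coboundaries I r U \<subseteq> cech_cocycles I r U"
proof
  fix c assume "c \<in> cech_coboundaries I r U"
  then obtain \<nu> where c: "c = cech_normalize I r U (\<lambda>\<alpha> \<beta> x. \<nu> \<alpha> x * \<nu> \<beta> x)"
    and \<nu>: "\<And>\<alpha>. \<alpha> \<in> I \<Longrightarrow> sign_function_on (U \<alpha>) (\<nu> \<alpha>)"
    unfolding cech_coboundaries_def by blast
  have tr: "trans r" "antisym r"
    using assms by (auto simp: order_on_defs)
  have less_trans: "index_less I r \<alpha> \<gamma>" if "index_less I r \<alpha> \<beta>" "index_less I r \<beta> \<gamma>" for \<alpha> \<beta> \<gamma>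
    using that tr unfolding index_less_def by (blast dest: antisymD transD)
  have "sign_function_on (U \<alpha> \<inter> U \<beta>) (c \<alpha> \<beta>)" if "index_less I r \<alpha> \<beta>" for \<alpha> \<beta>
  proof (rule sign_function_on_cong)
    show "sign_function_on (U \<alpha> \<inter> U \<beta>) (\<lambda>x. \<nu> \<alpha> x * \<nu> \<beta> x)"
      using that unfolding index_less_def
      by (intro sign_function_on_mult) (auto intro: sign_function_on_subset[OF \<nu>])
    show "\<nu> \<alpha> x * \<nu> \<beta> x = c \<alpha> \<beta> x" if "x \<in> U \<alpha> \<inter> U \<beta>" for x
      using that \<open>index_less I r \<alpha> \<beta>\<close> by (simp add: c cech_normalize_def)
  qed
  moreover have "c \<alpha> \<gamma> x = c \<alpha> \<beta> x * c \<beta> \<gamma> x"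
    if "index_less I r \<alpha> \<beta>" "index_less I r \<beta> \<gamma>" "x \<in> U \<alpha> \<inter> U \<beta> \<inter> U \<gamma>" for \<alpha> \<beta> \<gamma> x
  proof -
    have "\<nu> \<beta> x \<in> {1, -1}"
      using \<nu>[of \<beta>] that unfolding index_less_def sign_function_on_def by blast
    then show ?thesis
      using that less_trans[OF that(1,2)] by (auto simp: c cech_normalize_def)
  qed
  moreover have "cech_normalize I r U c = c"
    by (simp add: c cech_normalize_def fun_eq_iff)
  ultimately show "c \<in> cech_cocycles I r U"
    unfolding cech_cocycles_def by blast
qed

lemma subgroup_cech_coboundaries:
  assumes "linear_order_on I r"
  shows "subgroup (cech_coboundaries I r U) (cech_Z1 I r U)"
proof -
  interpret comm_group "cech_Z1 I r U" by (rule comm_group_cech_Z1)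
  note sub = cech_coboundaries_subset[OF assms, of U]
  show ?thesis
  proof (rule subgroupI)
    show "cech_coboundaries I r U \<subseteq> carrier (cech_Z1 I r U)"
      using sub by (simp add: cech_Z1_def)
    show "cech_coboundaries I r U \<noteq> {}"
      by (auto simp: cech_coboundaries_def intro!: exI[of _ "\<lambda>_ _. 1"] sign_function_on_one)
  next
    fix c assume c: "c \<in> cech_coboundaries I r U"
    have "inv\<^bsub>cech_Z1 I r U\<^esub> c = c"
      by (rule inv_equality) (use c sub in \<open>auto simp: cech_Z1_def cech_cocycle_square\<close>)
    then show "inv\<^bsub>cech_Z1 I r U\<^esub> c \<in> cech_coboundaries I r U" using c by simp
  next
    fix b c assume "b \<in> cech_coboundaries I r U" "c \<in> cech_coboundaries I r U"
    then obtain \<mu> \<nu> where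
      b: "b = cech_normalize I r U (\<lambda>\<alpha> \<beta> x. \<mu> \<alpha> x * \<mu> \<beta> x)" and
      c: "c = cech_normalize I r U (\<lambda>\<alpha> \<beta> x. \<nu> \<alpha> x * \<nu> \<beta> x)" and
      s: "\<forall>\<alpha>\<in>I. sign_function_on (U \<alpha>) (\<mu> \<alpha>)" "\<forall>\<alpha>\<in>I. sign_function_on (U \<alpha>) (\<nu> \<alpha>)"
      unfolding cech_coboundaries_def by blast
    have "b \<otimes>\<^bsub>cech_Z1 I r U\<^esub> c =
        cech_normalize I r U (\<lambda>\<alpha> \<beta> x. (\<mu> \<alpha> x * \<nu> \<alpha> x) * (\<mu> \<beta> x * \<nu> \<beta> x))"
      by (auto simp: b c cech_Z1_def cech_normalize_def fun_eq_iff)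
    then show "b \<otimes>\<^bsub>cech_Z1 I r U\<^esub> c \<in> cech_coboundaries I r U"
      unfolding cech_coboundaries_def using s
      by (intro CollectI exI[of _ "\<lambda>\<alpha> x. \<mu> \<alpha> x * \<nu> \<alpha> x"]) (simp add: sign_function_on_mult)
  qed
qed

theorem comm_group_cech_H1:
  assumes "linear_order_on I r"
  shows "comm_group (cech_H1 I r U)"
  unfolding cech_H1_def
  by (intro comm_group.abelian_FactGroup comm_group_cech_Z1 subgroup_cech_coboundaries assms)

text \<open>Note the swap of indices: the value at \<open>\<alpha> < \<beta>\<close> is \<open>\<omega>\<^sub>\<beta>\<^sub>\<alpha>\<close>.\<close>

definition omega_cech ::
    "'i set \<Rightarrow> ('i \<times> 'i) set \<Rightarrow> ('i \<Rightarrow> ('n::finite, 'd::finite) ae_chart) \<Rightarrow>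
     'i \<Rightarrow> 'i \<Rightarrow> real^'n \<Rightarrow> real" where
  "omega_cech I r A =
     cech_normalize I r (\<lambda>i. patch (A i)) (\<lambda>\<alpha> \<beta>. omega A \<beta> \<alpha>)"

text \<open>Nonvanishing, uniformly bounded below, of the determinants whose signs form the cochain.\<close>

definition dets_bounded_away ::
    "'i set \<Rightarrow> ('i \<times> 'i) set \<Rightarrow> ('i \<Rightarrow> ('n::finite, 'd::finite) ae_chart) \<Rightarrow> bool" where
  "dets_bounded_away I r A \<longleftrightarrow>
     (\<exists>c>0. \<forall>\<alpha> \<beta>. index_less I r \<alpha> \<beta> \<longrightarrow>
        (\<forall>x \<in> patch (A \<alpha>) \<inter> patch (A \<beta>). c \<le> \<bar>det (trans_jac A \<beta> \<alpha> x)\<bar>))"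

end

theory Submission
  imports Defs
begin

text \<open>For \<open>x\<close> in a triple overlap put \<open>y = D\<^sub>i(E\<^sub>i(x))\<close> and \<open>w = E\<^sub>j(y)\<close>, and let \<open>H\<close> be the Jacobian
  of \<open>T\<^sub>k\<^sub>j\<close> at \<open>w\<close>. Then \<open>H g\<^sub>j\<^sub>i(x)\<close> is the Jacobian of \<open>E\<^sub>k D\<^sub>j E\<^sub>j D\<^sub>i\<close> at \<open>E\<^sub>i(x)\<close>. It differs from
  \<open>g\<^sub>k\<^sub>i(x)\<close> by at most \<open>\<Gamma>\<close>, because \<open>d(D\<^sub>j E\<^sub>j)\<close> is close to the identity on tangent vectors and the
  range of \<open>dD\<^sub>i\<close> is close to the tangent space; and \<open>H\<close> differs from \<open>g\<^sub>k\<^sub>j(x)\<close> by at most \<open>C\<^sub>g \<epsilon>\<close>,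
  because \<open>w\<close> is close to \<open>E\<^sub>j(x)\<close>. Both perturbations are too small to change the sign of the
  determinant: a singular matrix on the segment would give a unit vector \<open>v\<close> that \<open>A\<close> shrinks to
  norm at most \<open>G\<close>, whereas \<open>|det A| \<le> \<parallel>A v\<parallel> \<parallel>A\<parallel>\<^sup>d\<^sup>-\<^sup>1\<close>.\<close>

subsection \<open>Perturbation of determinants\<close>

text \<open>Leibniz expansion with \<open>d!\<close> summands. The factor \<open>d!\<close> does no
  harm, since the bound is applied to all powers of a fixed matrix at once.\<close>

lemma abs_det_le_fact:
  fixes A :: "real^'d^'d"
  assumes "\<And>i j. \<bar>A $ i $ j\<bar> \<le> c"
  shows "\<bar>det A\<bar> \<le> fact CARD('d) * c ^ CARD('d)"
proof -
  have "\<bar>det A\<bar> \<le> (\<Sum>p | p permutes (UNIV :: 'd set). \<bar>of_int (sign p) * (\<Prod>i\<in>UNIV. A $ i $ p i)\<bar>)"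
    unfolding det_def by (rule sum_abs)
  also have "\<dots> \<le> (\<Sum>p | p permutes (UNIV :: 'd set). c ^ CARD('d))"
  proof (rule sum_mono)
    fix p :: "'d \<Rightarrow> 'd"
    have "(\<Prod>i\<in>UNIV. \<bar>A $ i $ p i\<bar>) \<le> (\<Prod>i\<in>(UNIV::'d set). c)"
      using assms by (intro prod_mono) auto
    then show "\<bar>of_int (sign p) * (\<Prod>i\<in>UNIV. A $ i $ p i)\<bar> \<le> c ^ CARD('d)"
      by (simp add: abs_mult abs_prod sign_def)
  qed
  finally show ?thesis by (simp add: card_permutations)
qed

text \<open>Powers of \<open>A\<close> turn the crude factor \<open>d!\<close> into \<open>1\<close>.\<close>

lemma abs_det_le_power:
  fixes A :: "real^'d^'d"
  assumes bound: "\<And>u. norm (A *v u) \<le> L * norm u"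
  shows "\<bar>det A\<bar> \<le> L ^ CARD('d)"
proof (rule ccontr)
  assume "\<not> ?thesis"
  then have less: "L ^ CARD('d) < \<bar>det A\<bar>" by simp
  have L: "L \<ge> 0"
    using bound[of "axis undefined 1"] by simp (meson norm_ge_zero order_trans)
  \<comment> \<open>\<open>P n\<close> is the \<open>n\<close>-th power of \<open>A\<close>. Its
    entries are at most \<open>L ^ n\<close>, so \<open>\<bar>det A\<bar> ^ n\<close> is at most
    \<open>d!\<close> times \<open>(L ^ d) ^ n\<close> for every \<open>n\<close>, which is
    impossible if \<open>\<bar>det A\<bar> > L ^ d\<close>.\<close>
  define P where "P n = (((**) A) ^^ n) (mat 1)" for n
  have P: "norm (P n *v u) \<le> L ^ n * norm u \<and> det (P n) = det A ^ n" for n u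
  proof (induction n)
    case (Suc n)
    have "norm (A *v (P n *v u)) \<le> L * (L ^ n * norm u)"
      using bound[of "P n *v u"] Suc L by (meson mult_left_mono order_trans)
    then show ?case using Suc by (simp add: P_def det_mul matrix_vector_mul_assoc mult.assoc)
  qed (simp add: P_def det_I)
  have "\<bar>P n $ i $ j\<bar> \<le> L ^ n" for n i j
  proof -
    have "P n $ i $ j = (P n *v axis j 1) $ i"
      by (simp add: matrix_vector_mult_basis column_def)
    then show ?thesis
      using P[of n "axis j 1"] component_le_norm_cart[of "P n *v axis j 1" i] by simp
  qed
  then have *: "\<bar>det A\<bar> ^ n \<le> fact CARD('d) * (L ^ CARD('d)) ^ n" for n
    using abs_det_le_fact[of "P n" "L ^ n"] P[of n] by (simp add: power_abs power_mult[symmetric] mult.commute)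
  have "L ^ CARD('d) / \<bar>det A\<bar> < 1"
    using less L by (auto simp: divide_less_eq)
  moreover have "0 < 1 / (fact CARD('d) :: real)" by simp
  ultimately obtain n where "(L ^ CARD('d) / \<bar>det A\<bar>) ^ n < 1 / fact CARD('d)"
    using real_arch_pow_inv by blast
  moreover have "\<bar>det A\<bar> > 0" using less L by (meson le_less_trans zero_le_power)
  ultimately show False
    using *[of n] by (simp add: power_divide field_simps)
qed

text \<open>Cramer's rule for the identity matrix; \<open>cramer_lemma\<close> replaces a column,
  hence the transposition.\<close>

lemma det_replace_row_mat_1:
  fixes b :: "real^'d"
  shows "det (\<chi> i. if i = k then b else axis i 1) = b $ k"
proof -
  have *: "transpose (\<chi> i. if i = k then b else axis i 1) =
      (\<chi> i j. if j = k then (mat 1 *v b) $ i else mat 1 $ i $ j)"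
    unfolding matrix_vector_mul_lid
    by (auto simp: transpose_def vec_eq_iff mat_def axis_def)
  show ?thesis by (subst det_transpose[symmetric], subst *, subst cramer_lemma) (simp add: det_I)
qed

text \<open>After an orthogonal change of basis \<open>v\<close> is a basis vector \<open>e\<^sub>k\<close>. Replacing \<open>w = A v\<close> by
  \<open>(L / \<parallel>w\<parallel>) w\<close> and projecting the other columns onto the complement of \<open>w\<close> keeps the norm
  bound \<open>L\<close> and scales the determinant by \<open>L / \<parallel>w\<parallel>\<close>.\<close>

lemma abs_det_le_norm_mult_power:
  fixes A :: "real^'d^'d"
  assumes bound: "\<And>u. norm (A *v u) \<le> L * norm u" and v: "norm v = 1"
  shows "\<bar>det A\<bar> \<le> norm (A *v v) * L ^ (CARD('d) - 1)"
proof (cases "A *v v = 0")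
  case True
  have "\<not> inj ((*v) A)"
    using True v by (metis injD matrix_vector_mult_0_right norm_zero zero_neq_one)
  then have "det A = 0"
    using det_nz_iff_inj[of "(*v) A"] by (auto simp: matrix_vector_mul_linear)
  then show ?thesis by (simp add: True)
next
  case False
  define k where "k = (undefined :: 'd)"
  obtain U :: "real^'d \<Rightarrow> real^'d" where U: "orthogonal_transformation U" "U (axis k 1) = v"
    using orthogonal_transformation_exists[of "axis k 1" v] v by auto
  have linU: "linear U" using U(1) orthogonal_transformation by blast
  define B where "B = A ** matrix U"
  have B: "B *v u = A *v (U u)" for u
    by (simp add: B_def matrix_vector_mul_assoc[symmetric] matrix_works linU)
  have normB: "norm (B *v u) \<le> L * norm u" for u
    using bound[of "U u"] orthogonal_transformation_norm[OF U(1)] by (simp add: B)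
  have detB: "\<bar>det B\<bar> = \<bar>det A\<bar>"
    using U(1) det_orthogonal_matrix[of "matrix U"]
    by (auto simp: B_def det_mul abs_mult orthogonal_transformation_matrix)
  define w where "w = A *v v"
  define p where "p = w /\<^sub>R norm w"
  have nw: "norm w > 0" using False by (simp add: w_def)
  have pp: "p \<bullet> p = 1" using nw by (simp add: p_def dot_square_norm power2_eq_square)
  have w: "w = norm w *\<^sub>R p" using nw by (simp add: p_def)
  have Bk: "B *v axis k 1 = w" by (simp add: B U(2) w_def)
  have L: "L > 0"
    using bound[of v] nw unfolding w_def v mult_1_right by (rule order.strict_trans2[rotated])
  \<comment> \<open>The row \<open>b\<close> is chosen so that \<open>(B ** W) *v u\<close> arises
    from \<open>B *v u\<close> by changing its component along the unit vector \<open>p\<close> to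
    \<open>L * u $ k\<close>.\<close>
  define b where "b = (- 1 / norm w) *\<^sub>R (p v* B) + (L / norm w + 1) *\<^sub>R axis k 1"
  have b: "b \<bullet> u = - (p \<bullet> (B *v u)) / norm w + (L / norm w + 1) * u $ k" for u
    by (simp add: b_def inner_add_left inner_diff_left dot_lmul_matrix inner_axis')
  define W :: "real^'d^'d" where "W = (\<chi> i. if i = k then b else axis i 1)"
  have "b $ k = b \<bullet> axis k 1" by (simp add: inner_axis)
  also have "\<dots> = - (p \<bullet> w) / norm w + (L / norm w + 1)"
    by (simp add: b Bk)
  also have "p \<bullet> w = norm w" by (subst w) (simp add: pp)
  finally have "b $ k = L / norm w" using nw by simp
  then have detW: "det W = L / norm w"
    unfolding W_def det_replace_row_mat_1 .
  have W: "W *v u = u + (b \<bullet> u - u $ k) *\<^sub>R axis k 1" for u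
    by (auto simp: vec_eq_iff W_def matrix_vector_mult_def axis_def inner_vec_def
        if_distrib[where f="\<lambda>x. x $ _"] if_distrib[where f="\<lambda>x. x * _"] cong: if_cong)
  have "norm ((B ** W) *v u) \<le> L * norm u" for u
  proof -
    define u' where "u' = u - u $ k *\<^sub>R axis k 1"
    have u: "u = u' + u $ k *\<^sub>R axis k 1" by (simp add: u'_def)
    have u'k: "u' \<bullet> axis k 1 = 0" by (simp add: u'_def inner_diff_left inner_axis inner_axis_axis)
    have "(norm (u' + u $ k *\<^sub>R axis k 1))\<^sup>2 = (norm u')\<^sup>2 + (u $ k)\<^sup>2"
      unfolding power2_norm_eq_inner
      by (simp add: inner_add_left inner_add_right u'k inner_commute[of "axis k 1"]
          inner_axis_axis power2_eq_square)
    then have nu: "(norm u)\<^sup>2 = (norm u')\<^sup>2 + (u $ k)\<^sup>2" by (simp flip: u)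
    define q where "q = B *v u'"
    have Bu: "B *v u = q + u $ k *\<^sub>R w"
      by (subst u) (simp add: q_def matrix_vector_right_distrib Bk matrix_vector_mult_scaleR)
    have pw: "p \<bullet> w = norm w" by (subst w) (simp add: pp)
    have "b \<bullet> u = (L * u $ k - p \<bullet> q) / norm w"
      using nw by (simp add: b Bu inner_add_right pw field_simps)
    then have "(B ** W) *v u = q + ((L * u $ k - p \<bullet> q) / norm w) *\<^sub>R w"
      by (simp add: matrix_vector_mul_assoc[symmetric] W matrix_vector_right_distrib Bk
          matrix_vector_mult_scaleR Bu matrix_vector_mult_diff_distrib scaleR_diff_left)
    also have "\<dots> = q + (L * u $ k - p \<bullet> q) *\<^sub>R p"
      by (simp add: p_def divide_inverse)
    finally have "(norm ((B ** W) *v u))\<^sup>2 = (norm (q + (L * u $ k - p \<bullet> q) *\<^sub>R p))\<^sup>2" by simp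
    \<comment> \<open>Pythagoras: the component of \<open>q\<close> along \<open>p\<close> is
      removed, and \<open>L * u $ k\<close> takes its place.\<close>
    also have "\<dots> = (norm q)\<^sup>2 - (p \<bullet> q)\<^sup>2 + (L * u $ k)\<^sup>2"
      by (simp add: power2_norm_eq_inner inner_add_left inner_add_right pp inner_commute[of q p])
         (simp add: power2_eq_square algebra_simps)
    also have "\<dots> \<le> (L * norm u')\<^sup>2 + (L * u $ k)\<^sup>2"
      using power_mono[OF normB[of u'] norm_ge_zero, of 2] zero_le_power2[of "p \<bullet> q"]
      unfolding q_def by linarith
    also have "\<dots> = (L * norm u)\<^sup>2" unfolding power_mult_distrib nu by (rule distrib_left[symmetric])
    finally show ?thesis
      by (rule power2_le_imp_le) (use L in simp)
  qed
  then have "\<bar>det (B ** W)\<bar> \<le> L ^ CARD('d)" by (rule abs_det_le_power)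
  then have "\<bar>det A\<bar> * L \<le> norm w * L ^ CARD('d)"
    using nw L by (simp add: det_mul detW abs_mult detB field_simps)
  also have "L ^ CARD('d) = L * L ^ (CARD('d) - 1)"
    by (metis Suc_diff_1 power_Suc zero_less_card_finite)
  finally show ?thesis using L by (simp add: w_def)
qed

lemma continuous_on_det [continuous_intros]:
  fixes A :: "'a::topological_space \<Rightarrow> real^'d^'d"
  assumes "\<And>i j. continuous_on S (\<lambda>x. A x $ i $ j)"
  shows "continuous_on S (\<lambda>x. det (A x))"
  unfolding det_def by (intro continuous_intros assms)

text \<open>Continuity reduces the claim to nonvanishing of the determinant on the segment from
  \<open>A\<close> to \<open>B\<close>. The shape of \<open>small\<close> is that of both conditions
  in \<open>triple_small\<close>, with \<open>\<Gamma>\<close> in one and \<open>C_g\<close> times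
  \<open>\<epsilon>\<close> in the other as \<open>G\<close>.\<close>

lemma sgn_det_perturbation:
  fixes A B :: "real^'d^'d"
  assumes A: "\<And>u. norm (A *v u) \<le> L * norm u"
    and AB: "\<And>u. norm (A *v u - B *v u) \<le> G * norm u"
    and small: "real CARD('d) * G * (L + G) ^ (CARD('d) - 1) < \<bar>det A\<bar>"
  shows "sgn (det B) = sgn (det A)"
proof -
  \<comment> \<open>A bound tested on a basis vector forces its constant to be nonnegative.\<close>
  have nonneg: "c \<ge> 0" if "\<And>u::real^'d. f u \<le> c * norm u" "\<And>u. f u \<ge> 0" for c and f
    using that(1)[of "axis undefined 1"] that(2)[of "axis undefined 1"] by simp
  have L: "L \<ge> 0" using A by (rule nonneg) simp
  have G: "G \<ge> 0" using AB by (rule nonneg) simp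
  define P where "P t = A + t *\<^sub>R (B - A)" for t
  have P: "P t *v u = A *v u - t *\<^sub>R (A *v u - B *v u)" for t u
    by (simp add: P_def matrix_vector_mult_add_rdistrib matrix_vector_mult_diff_rdistrib
        scaleR_matrix_vector_assoc[symmetric] algebra_simps)
  have nz: "det (P t) \<noteq> 0" if t: "0 \<le> t" "t \<le> 1" for t
  proof
    assume "det (P t) = 0"
    then have "\<not> inj ((*v) (P t))"
      using det_nz_iff_inj[of "(*v) (P t)"] by (auto simp: matrix_vector_mul_linear)
    then obtain u where u: "P t *v u = 0" "u \<noteq> 0"
      by (metis linear_injective_0 matrix_vector_mul_linear)
    define v where "v = u /\<^sub>R norm u"
    have v: "norm v = 1" "P t *v v = 0"
      using u by (auto simp: v_def matrix_vector_mult_scaleR)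
    \<comment> \<open>Since \<open>P t\<close> kills \<open>v\<close>, the vector
      \<open>A *v v\<close> is \<open>t\<close> times \<open>A *v v - B *v v\<close>.\<close>
    have "norm (A *v v) = \<bar>t\<bar> * norm (A *v v - B *v v)"
      using v(2) unfolding P by (metis eq_iff_diff_eq_0 norm_scaleR)
    also have "\<dots> \<le> 1 * (G * norm v)"
      using t by (intro mult_mono AB) auto
    finally have "norm (A *v v) \<le> G" using v by simp
    then have "\<bar>det A\<bar> \<le> G * L ^ (CARD('d) - 1)"
      using abs_det_le_norm_mult_power[OF A v(1)] L
      by (meson mult_right_mono order_trans zero_le_power)
    also have "\<dots> \<le> (real CARD('d) * G) * (L + G) ^ (CARD('d) - 1)"
    proof (intro mult_mono power_mono)
      have "1 \<le> real CARD('d)" by (simp add: Suc_le_eq)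
      from mult_right_mono[OF this G] show "G \<le> real CARD('d) * G" by simp
    qed (use L G in auto)
    finally show False using small by linarith
  qed
  have "continuous_on {0..1} (\<lambda>t. det (P t))"
    by (intro continuous_intros) (auto simp: P_def intro!: continuous_intros)
  then have conn: "connected ((\<lambda>t. det (P t)) ` {0..1})"
    by (intro connected_continuous_image) auto
  have P01: "P 0 = A" "P 1 = B" by (auto simp: P_def)
  have mem: "det A \<in> (\<lambda>t. det (P t)) ` {0..1}" "det B \<in> (\<lambda>t. det (P t)) ` {0..1}"
    using P01 by (force intro: image_eqI[of _ _ 0], force intro: image_eqI[of _ _ 1])
  have "0 \<notin> (\<lambda>t. det (P t)) ` {0..1}" using nz by force
  \<comment> \<open>The image of the segment is connected and misses \<open>0\<close>, so both
    endpoint values have the same sign.\<close>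
  then have "\<not> (det A \<le> 0 \<and> 0 \<le> det B)" "\<not> (det B \<le> 0 \<and> 0 \<le> det A)"
    using connectedD_interval[OF conn mem] connectedD_interval[OF conn mem(2,1)] by blast+
  then show ?thesis
    by (auto simp: sgn_if)
qed

subsection \<open>Tangent vectors\<close>

text \<open>On an open set, equality at all points is equality near each point, so the derivatives
  agree too and the induction passes to them.\<close>

lemma Ck_on_cong_open:
  assumes "open S" "Ck_on k f S" "\<And>x. x \<in> S \<Longrightarrow> f x = g x"
  shows "Ck_on k g S"
  using assms(2,3)
proof (induction k arbitrary: f g)
  case 0
  then show ?case by (simp cong: continuous_on_cong)
next
  case (Suc k)
  have "g differentiable at x" if "x \<in> S" for x
  proof -
    have "f differentiable at x" using Suc.prems(1) that by simp
    then obtain f' where "(f has_derivative f') (at x)" unfolding differentiable_def by blast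
    then have "(g has_derivative f') (at x)"
      using assms(1) that Suc.prems(2) by (rule has_derivative_transform_within_open)
    then show ?thesis by (auto simp: differentiable_def)
  qed
  moreover have "Ck_on k (\<lambda>x. frechet_derivative g (at x) v) S" for v
  proof (rule Suc.IH)
    show "Ck_on k (\<lambda>x. frechet_derivative f (at x) v) S" using Suc.prems by simp
    show "frechet_derivative f (at x) v = frechet_derivative g (at x) v" if "x \<in> S" for x
      using Suc.prems that assms(1)
      by (simp add: frechet_derivative_transform_within_open[of f x S g])
  qed
  ultimately show ?case by simp
qed

text \<open>By the chain rule the derivative in direction \<open>s\<close> is a directional
  derivative of \<open>f\<close>, along \<open>s\<close> times \<open>v\<close>, composed with the
  same line; hence the induction over arbitrary \<open>f\<close>.\<close>

lemma Ck_on_compose_line: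
  fixes S :: "real set"
  assumes "open S" "Ck_on k f W" "\<And>t. t \<in> S \<Longrightarrow> a + t *\<^sub>R v \<in> W"
  shows "Ck_on k (\<lambda>t. f (a + t *\<^sub>R v)) S"
  using assms(2)
proof (induction k arbitrary: f)
  case 0
  have "continuous_on S (\<lambda>t. a + t *\<^sub>R v)" by (intro continuous_intros)
  then show ?case using 0 assms(3) by (auto intro: continuous_on_compose2)
next
  case (Suc k)
  have der: "((\<lambda>t. f (a + t *\<^sub>R v)) has_derivative
      (\<lambda>s. frechet_derivative f (at (a + t *\<^sub>R v)) (s *\<^sub>R v))) (at t)" if "t \<in> S" for t
  proof -
    have "(f has_derivative frechet_derivative f (at (a + t *\<^sub>R v))) (at (a + t *\<^sub>R v))"
      using Suc.prems assms(3)[OF that] by (simp add: frechet_derivative_works[symmetric])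
    moreover have "((\<lambda>t. a + t *\<^sub>R v) has_derivative (\<lambda>s. s *\<^sub>R v)) (at t)"
      by (auto intro!: derivative_eq_intros)
    ultimately show ?thesis by (rule has_derivative_compose[rotated])
  qed
  have "Ck_on k (\<lambda>t. frechet_derivative (\<lambda>t. f (a + t *\<^sub>R v)) (at t) s) S" for s
  proof (rule Ck_on_cong_open[OF assms(1)])
    show "Ck_on k (\<lambda>t. frechet_derivative f (at (a + t *\<^sub>R v)) (s *\<^sub>R v)) S"
      using Suc.prems by (intro Suc.IH[of "\<lambda>x. frechet_derivative f (at x) (s *\<^sub>R v)"]) simp
    show "frechet_derivative f (at (a + t *\<^sub>R v)) (s *\<^sub>R v) =
        frechet_derivative (\<lambda>t. f (a + t *\<^sub>R v)) (at t) s" if "t \<in> S" for t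
      using frechet_derivative_at[OF der[OF that]] by metis
  qed
  then show ?case using der by (auto simp: differentiable_def)
qed

text \<open>The image under \<open>\<phi>\<close> of a short straight line through \<open>u\<close>
  with direction \<open>v\<close> is a smooth curve in \<open>M\<close> with the required
  velocity.\<close>

lemma range_derivative_subset_tangent_space:
  assumes "open W" "smooth_on \<phi> W" "\<phi> ` W \<subseteq> M" "u \<in> W"
  shows "range (frechet_derivative \<phi> (at u)) \<subseteq> tangent_space M (\<phi> u)"
proof safe
  fix v :: 'a
  obtain e where e: "e > 0" "ball u e \<subseteq> W" using assms(1,4) openE by blast
  \<comment> \<open>For \<open>\<bar>t\<bar> < e'\<close> the line stays in the ball of radius
    \<open>e\<close>; the summand \<open>1\<close> covers \<open>v = 0\<close>.\<close>
  define e' where "e' = e / (norm v + 1)"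
  have np: "norm v + 1 > 0" by (simp add: add_nonneg_pos)
  then have "e' > 0" using e by (simp add: e'_def)
  have inW: "u + t *\<^sub>R v \<in> W" if "t \<in> {-e'<..<e'}" for t
  proof -
    have "\<bar>t\<bar> * norm v \<le> e' * norm v" using that by (intro mult_right_mono) auto
    also have "\<dots> < e' * (norm v + 1)" using \<open>e' > 0\<close> by simp
    also have "\<dots> = e" unfolding e'_def using np by simp
    finally show ?thesis using e(2) by (auto simp: dist_norm)
  qed
  have "Ck_on 1 \<phi> W" using assms(2) unfolding smooth_on_def by blast
  then have "(\<phi> has_derivative frechet_derivative \<phi> (at u)) (at u)"
    using assms(4) by (simp add: frechet_derivative_works[symmetric])
  then have der: "(\<phi> has_derivative frechet_derivative \<phi> (at u)) (at (u + 0 *\<^sub>R v))" by simp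
  have "((\<lambda>t. u + t *\<^sub>R v) has_derivative (\<lambda>s. s *\<^sub>R v)) (at 0)"
    by (auto intro!: derivative_eq_intros)
  from has_derivative_compose[OF this der]
  have "((\<lambda>t. \<phi> (u + t *\<^sub>R v)) has_vector_derivative frechet_derivative \<phi> (at u) v) (at 0)"
    unfolding has_vector_derivative_def
    using linear_scale[OF has_derivative_linear[OF der]] by simp
  moreover have "smooth_on (\<lambda>t. \<phi> (u + t *\<^sub>R v)) {-e'<..<e'}"
    using assms(2) inW unfolding smooth_on_def by (auto intro!: Ck_on_compose_line)
  moreover have "(\<lambda>t. \<phi> (u + t *\<^sub>R v)) ` {-e'<..<e'} \<subseteq> M" using inW assms(3) by blast
  ultimately show "frechet_derivative \<phi> (at u) v \<in> tangent_space M (\<phi> u)"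
    unfolding tangent_space_def using \<open>e' > 0\<close>
    by (intro CollectI exI[of _ "\<lambda>t. \<phi> (u + t *\<^sub>R v)"] exI[of _ e']) simp
qed

text \<open>The tangent space enters the estimates only through this \<open>d\<close>-dimensional
  linear space of velocities, the range of the derivative of a local parametrisation.\<close>

lemma tangent_frame:
  fixes M :: "(real^'n) set"
  assumes "smooth_submanifold TYPE('d::finite) M" "x \<in> M"
  obtains F :: "real^'d \<Rightarrow> real^'n"
  where "linear F" "inj F" "range F \<subseteq> tangent_space M x"
proof -
  obtain V W and \<phi> :: "real^'d \<Rightarrow> real^'n" and \<psi> where
    V: "open W" "x \<in> V" "smooth_on \<phi> W" "\<forall>u\<in>W. inj (frechet_derivative \<phi> (at u))"
      "homeomorphism W (M \<inter> V) \<phi> \<psi>"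
    using assms unfolding smooth_submanifold_def by metis
  define u where "u = \<psi> x"
  have u: "u \<in> W" "\<phi> u = x" "\<phi> ` W \<subseteq> M"
    using V(2,5) assms(2) unfolding u_def homeomorphism_def by blast+
  have "Ck_on 1 \<phi> W" using V(3) unfolding smooth_on_def by blast
  then have "linear (frechet_derivative \<phi> (at u))"
    using u(1) by (simp add: linear_frechet_derivative)
  then show ?thesis
    using that range_derivative_subset_tangent_space[OF V(1,3) u(3,1)] V(4) u by auto
qed

text \<open>A real supremum is an upper bound once the set is bounded above; here
  \<open>onorm f\<close> bounds all quotients.\<close>

lemma norm_le_onorm_on:
  assumes "bounded_linear f" "v \<in> T"
  shows "norm (f v) \<le> onorm_on T f * norm v"
proof (cases "v = 0")
  case True
  then show ?thesis using assms(1) by (simp add: linear_simps)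
next
  case False
  have "bdd_above ((\<lambda>v. norm (f v) / norm v) ` T)"
  proof (rule bdd_aboveI2)
    show "norm (f w) / norm w \<le> onorm f" for w by (rule le_onorm[OF assms(1)])
  qed
  then have "norm (f v) / norm v \<le> onorm_on T f"
    unfolding onorm_on_def using assms(2) by (rule cSUP_upper[rotated])
  then show ?thesis using False by (simp add: field_simps)
qed

text \<open>Boundedness of the defects makes the supremum \<open>eta1\<close> an upper bound; an
  atlas supplies it through its own \<open>\<eta>\<close>.\<close>

lemma norm_tangent_defect_le_eta1:
  assumes "bdd_above (tangent_defect M a ` patch a)" "x \<in> patch a"
    and "dec a \<circ> enc a differentiable at x" "v \<in> tangent_space M x"
  shows "norm (frechet_derivative (dec a \<circ> enc a) (at x) v - v) \<le> eta1 M a * norm v"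
proof -
  have "bounded_linear (\<lambda>v. frechet_derivative (dec a \<circ> enc a) (at x) v - v)"
    using assms(3) by (intro bounded_linear_intros) (auto simp: frechet_derivative_works
        dest: has_derivative_bounded_linear)
  then have "norm (frechet_derivative (dec a \<circ> enc a) (at x) v - v) \<le> tangent_defect M a x * norm v"
    unfolding tangent_defect_def using assms(4) by (rule norm_le_onorm_on)
  also have "\<dots> \<le> eta1 M a * norm v"
    unfolding eta1_def using assms(1,2) by (intro mult_right_mono cSUP_upper) auto
  finally show ?thesis .
qed

subsection \<open>The sign identity on a triple overlap\<close>

lemma transition_derivative:
  assumes "dec (A i) differentiable at (enc (A i) x)"
    and "enc (A l) differentiable at (dec (A i) (enc (A i) x))"
  shows "trans_jac A l i x = matrix (frechet_derivative (enc (A l)) (at (dec (A i) (enc (A i) x))) \<circ>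
    frechet_derivative (dec (A i)) (at (enc (A i) x)))"
  by (simp add: trans_jac_def transition_def jacobian_def frechet_derivative_compose assms)

lemma approx_ae_atlasD:
  assumes "approx_ae_atlas M I A \<epsilon> \<eta>" "i \<in> I"
  shows "patch (A i) \<subseteq> M" "open (nbhd (A i))" "patch (A i) \<subseteq> nbhd (A i)"
    "open (latent (A i))" "enc (A i) ` nbhd (A i) \<subseteq> latent (A i)"
    "Ck_on 1 (enc (A i)) (nbhd (A i))" "Ck_on 1 (dec (A i)) (latent (A i))"
    "\<And>p. p \<in> nbhd (A i) \<Longrightarrow> enc (A i) differentiable at p"
    "\<And>p. p \<in> nbhd (A i) \<Longrightarrow> dec (A i) differentiable at (enc (A i) p)"
    "\<And>x. x \<in> patch (A i) \<Longrightarrow> norm (dec (A i) (enc (A i) x) - x) \<le> \<epsilon>"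
    "bdd_above (tangent_defect M (A i) ` patch (A i))"
proof -
  show *: "patch (A i) \<subseteq> M" "open (nbhd (A i))" "patch (A i) \<subseteq> nbhd (A i)"
    "open (latent (A i))" "enc (A i) ` nbhd (A i) \<subseteq> latent (A i)"
    "Ck_on 1 (enc (A i)) (nbhd (A i))" "Ck_on 1 (dec (A i)) (latent (A i))"
    using assms unfolding approx_ae_atlas_def by blast+
  show "enc (A i) differentiable at p" if "p \<in> nbhd (A i)" for p
    using *(6) that by simp
  show "dec (A i) differentiable at (enc (A i) p)" if "p \<in> nbhd (A i)" for p
    using *(5,7) that by auto
  show "norm (dec (A i) (enc (A i) x) - x) \<le> \<epsilon>" if "x \<in> patch (A i)" for x
    using assms that unfolding approx_ae_atlas_def by blast
  show "bdd_above (tangent_defect M (A i) ` patch (A i))"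
    by (rule bdd_aboveI2[of _ _ \<eta>]) (use assms in \<open>simp add: approx_ae_atlas_def\<close>)
qed

lemma enlarged_nbhdsD:
  assumes "enlarged_nbhds I A \<epsilon> R" "i \<in> I" "x \<in> patch (A i)" "norm (p - x) \<le> R * \<epsilon>"
  shows "p \<in> nbhd (A i)"
proof -
  have "infdist p (patch (A i)) \<le> R * \<epsilon>"
    using infdist_le[OF assms(3), of p] assms(4) by (simp add: dist_norm)
  then show ?thesis using assms(1-3) unfolding enlarged_nbhds_def by blast
qed

lemma norm_le_onorm_bound:
  assumes "bounded_linear f" "onorm f \<le> c"
  shows "norm (f v) \<le> c * norm v"
  using onorm[OF assms(1), of v] mult_right_mono[OF assms(2) norm_ge_zero[of v]] by linarith

text \<open>Since \<open>\<eta> < 1\<close>, the map \<open>d(D E)\<close> is injective on a \<open>d\<close>-dimensional space of tangent vectors,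
  whose image must then be the whole range of \<open>dD\<close>.\<close>

lemma decoder_range_tangent:
  fixes P :: "real^'d \<Rightarrow> real^'n" and Q :: "real^'n \<Rightarrow> real^'d"
  assumes lin: "linear P" "linear Q" "linear F" and F: "inj F"
    and defect: "\<And>s::real^'d. norm (P (Q (F s)) - F s) \<le> \<eta> * norm (F s)" and \<eta>: "\<eta> < 1"
  obtains s where "P (Q (F s)) = P u" "norm (F s) \<le> norm (P u) / (1 - \<eta>)"
proof -
  \<comment> \<open>Reverse triangle inequality. The factor \<open>1 - \<eta>\<close> becomes the
    denominator in \<open>eta_eff\<close>.\<close>
  have bound: "(1 - \<eta>) * norm (F s) \<le> norm (P (Q (F s)))" for s
    using defect[of s] norm_triangle_ineq2[of "F s" "P (Q (F s))"]
    by (simp add: norm_minus_commute algebra_simps)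
  have "linear (Q \<circ> F)" using lin by (simp add: linear_compose)
  moreover have "inj (Q \<circ> F)"
    unfolding linear_injective_0[OF \<open>linear (Q \<circ> F)\<close>]
  proof safe
    fix s assume "(Q \<circ> F) s = 0"
    then have "(1 - \<eta>) * norm (F s) \<le> 0" using bound[of s] lin by (simp add: linear_0)
    then have "F s = F 0" using \<eta> lin by (simp add: linear_0 mult_le_0_iff)
    then show "s = 0" using F by (simp add: inj_eq)
  qed
  ultimately have "surj (Q \<circ> F)" using linear_injective_imp_surjective by blast
  then obtain s where s: "Q (F s) = u" by (metis comp_apply surjD)
  show ?thesis using that[of s] bound[of s] s \<eta> by (simp add: field_simps)
qed

text \<open>Two comparisons meet in the determinant of \<open>H ** trans_jac A j i x\<close>: one
  gives it the sign of \<open>det (trans_jac A k i x)\<close>, the other replaces the sign of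
  \<open>det H\<close> by that of \<open>det (trans_jac A k j x)\<close>. The letters
  \<open>L\<close>, \<open>L'\<close>, \<open>D\<close>, \<open>D'\<close> stand for
  \<open>L\<^sub>E\<close>, \<open>L\<^sub>E'\<close>, \<open>L\<^sub>D\<close>,
  \<open>L\<^sub>D'\<close>.\<close>

lemma omega_triple:
  fixes M :: "(real^'n::finite) set" and A :: "'i \<Rightarrow> ('n, 'd::finite) ae_chart"
  assumes M: "smooth_submanifold TYPE('d) M" and atlas: "approx_ae_atlas M I A \<epsilon> \<eta>\<^sub>0"
    and I: "i \<in> I" "j \<in> I" "k \<in> I"
    and bounds: "triple_bounds M A \<epsilon> i j k L L' D D'"
    and enl: "enlarged_nbhds I A \<epsilon> (L * D + 3)"
    and small: "triple_small M A \<epsilon> i j k L L' D D'"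
    and x: "x \<in> patch (A i)" "x \<in> patch (A j)" "x \<in> patch (A k)"
  shows "omega A k i x = omega A k j x * omega A j i x"
proof -

  \<comment> \<open>Constants and lower bounds for the determinants\<close>
  define dE where "dE l p = frechet_derivative (enc (A l)) (at p)" for l p
  define dD where "dD l z = frechet_derivative (dec (A l)) (at z)" for l z
  note chart = approx_ae_atlasD[OF atlas]
  define \<eta> where "\<eta> = eta3 M A i j k"
  define \<Gamma> where "\<Gamma> = Gamma3 L L' D D' \<epsilon> \<eta>"
  define eff where "eff = eta_eff L L' D D' \<epsilon> \<eta>"
  define C where "C = C_g L L' D D'"
  have small': "\<eta> < 1" "delta3 A i j k > 0"
    "real CARD('d) * \<Gamma> * (L * D + \<Gamma>) ^ (CARD('d) - 1) < delta3 A i j k"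
    "real CARD('d) * (C * \<epsilon>) * (L * D + C * \<epsilon>) ^ (CARD('d) - 1) < delta3 A i j k"
    using small unfolding triple_small_def Let_def \<eta>_def \<Gamma>_def C_def K_det_def
    by (auto simp: mult.assoc)
  \<comment> \<open>Absolute values are bounded below by \<open>0\<close>, so the real infimum is
    indeed a lower bound.\<close>
  have inf: "(INF x \<in> X. \<bar>det (trans_jac A b a x)\<bar>) \<le> \<bar>det (trans_jac A b a x)\<bar>" if "x \<in> X" for X b a
    using that by (intro cINF_lower bdd_belowI2[where m=0]) auto
  have "delta3 A i j k \<le> \<bar>det (trans_jac A j i x)\<bar>" "delta3 A i j k \<le> \<bar>det (trans_jac A k i x)\<bar>"
    "delta3 A i j k \<le> \<bar>det (trans_jac A k j x)\<bar>"
    using inf[of "patch (A i) \<inter> patch (A j)" j i] inf[of "patch (A i) \<inter> patch (A k)" k i]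
      inf[of "patch (A j) \<inter> patch (A k)" k j] x
    by (simp_all add: delta3_def min_le_iff_disj)
  note \<delta> = this

  define y where "y = dec (A i) (enc (A i) x)"
  define y' where "y' = dec (A j) (enc (A j) x)"
  have y: "norm (y - x) \<le> \<epsilon>" and y': "norm (y' - x) \<le> \<epsilon>"
    using chart(10)[OF I(1) x(1)] chart(10)[OF I(2) x(2)] by (auto simp: y_def y'_def)
  have \<epsilon>: "\<epsilon> \<ge> 0" using y norm_ge_zero by (rule order.trans[rotated])
  have xn: "x \<in> nbhd (A i)" "x \<in> nbhd (A j)" "x \<in> nbhd (A k)"
    using x chart(3) I by blast+

  \<comment> \<open>Pointwise bounds for the derivatives of encoders and decoders\<close>
  have linE: "bounded_linear (dE l p)" if "l \<in> I" "p \<in> nbhd (A l)" for l p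
    using chart(8)[OF that] unfolding dE_def
    by (simp add: frechet_derivative_works has_derivative_bounded_linear)
  have linD: "bounded_linear (dD l (enc (A l) p))" if "l \<in> I" "p \<in> nbhd (A l)" for l p
    using chart(9)[OF that] unfolding dD_def
    by (simp add: frechet_derivative_works has_derivative_bounded_linear)
  have onE: "onorm (dE l p) \<le> L" if "l \<in> {j, k}" "p \<in> nbhd (A l)" for l p
    using bounds that unfolding triple_bounds_def dE_def by blast
  have onD: "onorm (dD l (enc (A l) p)) \<le> D" if "l \<in> {i, j}" "p \<in> nbhd (A l)" for l p
    using bounds that unfolding triple_bounds_def dD_def by blast
  have onE': "onorm (\<lambda>v. dE l p v - dE l q v) \<le> L' * norm (p - q)"
    if "l \<in> {j, k}" "p \<in> nbhd (A l)" "q \<in> nbhd (A l)" for l p q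
    using bounds that unfolding triple_bounds_def dE_def by blast
  have onD': "onorm (\<lambda>v. dD l (enc (A l) p) v - dD l (enc (A l) q) v) \<le> D' * norm (enc (A l) p - enc (A l) q)"
    if "l \<in> {i, j}" "p \<in> nbhd (A l)" "q \<in> nbhd (A l)" for l p q
    using bounds that unfolding triple_bounds_def dD_def by blast
  have E: "norm (dE l p v) \<le> L * norm v" if "l \<in> {j, k}" "p \<in> nbhd (A l)" for l p v
    using that I by (intro norm_le_onorm_bound linE onE) auto
  have D: "norm (dD l (enc (A l) p) v) \<le> D * norm v" if "l \<in> {i, j}" "p \<in> nbhd (A l)" for l p v
    using that I by (intro norm_le_onorm_bound linD onD) auto
  have E': "norm (dE l p v - dE l q v) \<le> L' * norm (p - q) * norm v"
    if "l \<in> {j, k}" "p \<in> nbhd (A l)" "q \<in> nbhd (A l)" for l p q v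
    using that I by (intro norm_le_onorm_bound[where f="\<lambda>v. dE l p v - dE l q v"] bounded_linear_sub linE onE') auto
  have D': "norm (dD l (enc (A l) p) v - dD l (enc (A l) q) v)
      \<le> D' * norm (enc (A l) p - enc (A l) q) * norm v"
    if "l \<in> {i, j}" "p \<in> nbhd (A l)" "q \<in> nbhd (A l)" for l p q v
    using that I
    by (intro norm_le_onorm_bound[where f="\<lambda>v. dD l (enc (A l) p) v - dD l (enc (A l) q) v"]
        bounded_linear_sub linD onD') auto
  have L: "L \<ge> 0" and Dnn: "D \<ge> 0"
    using onE[of j x] onD[of j x] xn onorm_pos_le[OF linE[OF I(2) xn(2)]] onorm_pos_le[OF linD[OF I(2) xn(2)]]
    by auto
  then have LD: "L * D \<ge> 0" by simp
  \<comment> \<open>An open set is not a singleton, so the Lipschitz bound can be tested at a second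
    point.\<close>
  have L': "L' \<ge> 0"
  proof -
    have "nbhd (A j) \<noteq> {x}" using chart(2)[OF I(2)] not_open_singleton by metis
    then obtain p where p: "p \<in> nbhd (A j)" "p \<noteq> x" using xn(2) by blast
    have "0 \<le> onorm (\<lambda>v. dE j p v - dE j x v)"
      by (intro onorm_pos_le bounded_linear_sub linE I p xn)
    also have "\<dots> \<le> L' * norm (p - x)" using p xn by (intro onE') auto
    finally show ?thesis using p(2) by (simp add: zero_le_mult_iff)
  qed

  \<comment> \<open>Position of the auxiliary points\<close>
  have near: "p \<in> nbhd (A l)" if "l \<in> {i, j, k}" "norm (p - x) \<le> (L * D + c) * \<epsilon>" "c \<le> 3" for l p c
  proof (rule enlarged_nbhdsD[OF enl])
    \<comment> \<open>This radius leaves room for \<open>y\<close> and \<open>y'\<close>, within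
      \<open>\<epsilon>\<close> of \<open>x\<close>, and for \<open>q\<close>, within
      \<open>(L * D + 1) * \<epsilon>\<close>.\<close>
    show "norm (p - x) \<le> (L * D + 3) * \<epsilon>"
      by (rule order.trans[OF that(2)]) (intro mult_right_mono, use that \<epsilon> in auto)
  qed (use that x I in auto)
  have near1: "p \<in> nbhd (A l)" if "l \<in> {i, j, k}" "norm (p - x) \<le> \<epsilon>" for l p
  proof (rule near[OF that(1), of _ 1])
    have "1 * \<epsilon> \<le> (L * D + 1) * \<epsilon>" using LD \<epsilon> by (intro mult_right_mono) auto
    then show "norm (p - x) \<le> (L * D + 1) * \<epsilon>" using that(2) by linarith
  qed simp

  have yn: "y \<in> nbhd (A l)" "y' \<in> nbhd (A l)" if "l \<in> {i, j, k}" for l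
    using near1 that y y' by blast+
  define w where "w = enc (A j) y"
  define q where "q = dec (A j) w"
  \<comment> \<open>The mean value inequality needs a convex domain containing \<open>x\<close> and
    \<open>y\<close>.\<close>
  have ball: "cball x \<epsilon> \<subseteq> nbhd (A j)" using near1[of j] by (auto simp: dist_norm norm_minus_commute)
  have ycb: "y \<in> cball x \<epsilon>" "x \<in> cball x \<epsilon>" using y \<epsilon> by (auto simp: dist_norm norm_minus_commute)
  have "norm (w - enc (A j) x) \<le> L * norm (y - x)"
    unfolding w_def
  proof (rule differentiable_bound[OF convex_cball _ _ ycb])
    fix p assume "p \<in> cball x \<epsilon>"
    then have p: "p \<in> nbhd (A j)" using ball by blast
    show "(enc (A j) has_derivative dE j p) (at p within cball x \<epsilon>)"
      using chart(8)[OF I(2) p] unfolding dE_def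
      by (simp add: frechet_derivative_works has_derivative_at_withinI)
    show "onorm (dE j p) \<le> L" using p by (intro onE) auto
  qed
  also have "\<dots> \<le> L * \<epsilon>" using y L by (intro mult_left_mono)
  finally have wz: "norm (w - enc (A j) x) \<le> L * \<epsilon>" .
  \<comment> \<open>The bound on \<open>dD j\<close> is known only on the image of
    \<open>nbhd (A j)\<close>, which need not contain the segment from \<open>w\<close> to
    \<open>enc (A j) x\<close>. So the mean value inequality is applied to the composite on the ball
    about \<open>x\<close>.\<close>
  have "norm (dec (A j) (enc (A j) y) - dec (A j) (enc (A j) x)) \<le> (D * L) * norm (y - x)"
  proof (rule differentiable_bound[OF convex_cball _ _ ycb])
    fix p assume "p \<in> cball x \<epsilon>"
    then have p: "p \<in> nbhd (A j)" using ball by blast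
    have "(enc (A j) has_derivative dE j p) (at p)"
      "(dec (A j) has_derivative dD j (enc (A j) p)) (at (enc (A j) p))"
      using chart(8,9)[OF I(2) p] unfolding dE_def dD_def by (simp_all add: frechet_derivative_works)
    from has_derivative_compose[OF this]
    show "((\<lambda>p. dec (A j) (enc (A j) p)) has_derivative (\<lambda>v. dD j (enc (A j) p) (dE j p v)))
        (at p within cball x \<epsilon>)"
      by (rule has_derivative_at_withinI)
    show "onorm (\<lambda>v. dD j (enc (A j) p) (dE j p v)) \<le> D * L"
    proof (rule onorm_le)
      fix v
      have "norm (dD j (enc (A j) p) (dE j p v)) \<le> D * norm (dE j p v)" using p by (intro D) auto
      also have "\<dots> \<le> D * (L * norm v)" using p Dnn by (intro mult_left_mono E) auto
      finally show "norm (dD j (enc (A j) p) (dE j p v)) \<le> D * L * norm v" by (simp add: mult.assoc)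
    qed
  qed
  also have "\<dots> \<le> (D * L) * \<epsilon>" using y LD by (intro mult_left_mono) (auto simp: mult.commute)
  finally have qy': "norm (q - y') \<le> L * D * \<epsilon>"
    by (simp add: q_def w_def y'_def mult.commute)
  have "norm (q - x) \<le> (L * D + 1) * \<epsilon>"
    using norm_triangle_ineq[of "q - y'" "y' - x"] qy' y' by (simp add: algebra_simps)
  then have qn: "q \<in> nbhd (A k)" by (intro near) auto
  \<comment> \<open>The path from \<open>y\<close> through \<open>x\<close> and \<open>y'\<close> to
    \<open>q\<close> gives the factor \<open>L * D + 2\<close> of \<open>Gamma3\<close>.\<close>
  have yq: "norm (y - q) \<le> (L * D + 2) * \<epsilon>"
    using norm_triangle_ineq[of "y - x" "x - y'"] norm_triangle_ineq[of "y - y'" "y' - q"]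
      qy' y' y by (simp add: norm_minus_commute algebra_simps)

  \<comment> \<open>Jacobians as compositions of derivatives\<close>
  have jac: "trans_jac A b a x = matrix (dE b (dec (A a) (enc (A a) x)) \<circ> dD a (enc (A a) x))"
    if "a \<in> I" "b \<in> I" "x \<in> nbhd (A a)" "dec (A a) (enc (A a) x) \<in> nbhd (A b)" for a b
    unfolding dE_def dD_def using that by (intro transition_derivative chart) auto
  have jacv: "trans_jac A b a x *v u = dE b (dec (A a) (enc (A a) x)) (dD a (enc (A a) x) u)"
    if "a \<in> I" "b \<in> I" "x \<in> nbhd (A a)" "dec (A a) (enc (A a) x) \<in> nbhd (A b)" for a b u
  proof -
    have "linear (dE b (dec (A a) (enc (A a) x)) \<circ> dD a (enc (A a) x))"
      by (intro linear_compose bounded_linear.linear linE linD that)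
    then show ?thesis by (simp add: jac[OF that] matrix_works)
  qed
  have Gji: "trans_jac A j i x *v u = dE j y (dD i (enc (A i) x) u)" for u
    using jacv[OF I(1,2) xn(1)] yn by (simp add: y_def)
  have Gki: "trans_jac A k i x *v u = dE k y (dD i (enc (A i) x) u)" for u
    using jacv[OF I(1,3) xn(1)] yn by (simp add: y_def)
  have Gkj: "trans_jac A k j x *v u = dE k y' (dD j (enc (A j) x) u)" for u
    using jacv[OF I(2,3) xn(2)] yn by (simp add: y'_def)
  \<comment> \<open>Bounds on \<open>dD j w\<close> are available because \<open>w\<close> is the
    latent image of \<open>y\<close>, a point of \<open>nbhd (A j)\<close>.\<close>
  define H where "H = matrix (dE k q \<circ> dD j w)"
  have H: "H *v u = dE k q (dD j w u)" for u
  proof -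
    have "linear (dE k q \<circ> dD j w)"
      unfolding w_def using yn by (intro linear_compose bounded_linear.linear linE linD I qn) auto
    then show ?thesis by (simp add: H_def matrix_works)
  qed

  txt \<open>A negative \<open>D'\<close> would force \<open>E\<^sub>j\<close> to be constant, hence \<open>det g\<^sub>j\<^sub>i = 0\<close>.\<close>
  have D'nn: "D' \<ge> 0"
  proof (rule ccontr)
    assume "\<not> D' \<ge> 0"
    have const: "enc (A j) p = enc (A j) x" if p: "p \<in> nbhd (A j)" for p
    proof -
      have "0 \<le> onorm (\<lambda>v. dD j (enc (A j) p) v - dD j (enc (A j) x) v)"
        by (intro onorm_pos_le bounded_linear_sub linD I p xn)
      also have "\<dots> \<le> D' * norm (enc (A j) p - enc (A j) x)" using p xn by (intro onD') auto
      finally show ?thesis using \<open>\<not> D' \<ge> 0\<close> by (simp add: zero_le_mult_iff)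
    qed
    have "((\<lambda>_. enc (A j) x) has_derivative (\<lambda>_. 0)) (at y)" by simp
    then have "(enc (A j) has_derivative (\<lambda>_. 0)) (at y)"
      by (rule has_derivative_transform_within_open[OF _ chart(2)[OF I(2)]])
        (use yn const in auto)
    then have "dE j y = (\<lambda>_. 0)" unfolding dE_def by (metis frechet_derivative_at)
    then have "trans_jac A j i x *v u = 0" for u by (simp add: Gji)
    then have "trans_jac A j i x = 0" by (metis matrix_eq matrix_vector_mult_0)
    then have "det (trans_jac A j i x) = 0" by (metis det_0 mat_0)
    then show False using \<delta> small' by simp
  qed

  \<comment> \<open>Comparison of \<open>H\<close> with the Jacobian of the transition from
    \<open>j\<close> to \<open>k\<close> at \<open>x\<close>\<close>
  have sgnH: "sgn (det H) = sgn (det (trans_jac A k j x))"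
  proof (rule sgn_det_perturbation[where L="L * D" and G="C * \<epsilon>"])
    show "norm (trans_jac A k j x *v u) \<le> L * D * norm u" for u
    proof -
      have "norm (dE k y' (dD j (enc (A j) x) u)) \<le> L * norm (dD j (enc (A j) x) u)"
        using yn by (intro E) auto
      also have "\<dots> \<le> L * (D * norm u)" using L xn by (intro mult_left_mono D) auto
      finally show ?thesis by (simp add: Gkj mult.assoc)
    qed
    show "norm (trans_jac A k j x *v u - H *v u) \<le> C * \<epsilon> * norm u" for u
    proof -
      define a where "a = dD j (enc (A j) x) u"
      define b where "b = dD j w u"
      have diff: "norm (a - b) \<le> D' * (L * \<epsilon>) * norm u"
      proof -
        have "norm (a - b) \<le> D' * norm (enc (A j) x - w) * norm u"
          unfolding a_def b_def w_def using xn yn by (intro D') auto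
        also have "\<dots> \<le> D' * (L * \<epsilon>) * norm u"
          using wz D'nn by (intro mult_right_mono mult_left_mono) (auto simp: norm_minus_commute)
        finally show ?thesis .
      qed
      have b: "norm b \<le> D * norm u" unfolding b_def w_def using yn by (intro D) auto
      \<comment> \<open>First the vector changes, then the base point; these yield the two summands
        of \<open>C_g\<close>.\<close>
      have "dE k y' a - dE k q b = dE k y' (a - b) + (dE k y' b - dE k q b)"
        using linE[OF I(3) yn(2)] by (simp add: linear_diff bounded_linear.linear)
      then have "norm (dE k y' a - dE k q b) \<le> norm (dE k y' (a - b)) + norm (dE k y' b - dE k q b)"
        by (simp only: norm_triangle_ineq)
      also have "\<dots> \<le> L * norm (a - b) + L' * norm (y' - q) * norm b"
        using yn qn by (intro add_mono E E') auto
      also have "\<dots> \<le> L * (D' * (L * \<epsilon>) * norm u) + L' * (L * D * \<epsilon>) * (D * norm u)"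
        using L L' Dnn \<epsilon> diff qy' b
        by (intro add_mono mult_left_mono mult_mono) (auto simp: norm_minus_commute)
      also have "\<dots> = C * \<epsilon> * norm u"
        by (simp add: C_def C_g_def algebra_simps power2_eq_square)
      finally show ?thesis by (simp add: Gkj H a_def b_def)
    qed
    show "real CARD('d) * (C * \<epsilon>) * (L * D + C * \<epsilon>) ^ (CARD('d) - 1) < \<bar>det (trans_jac A k j x)\<bar>"
      using small'(4) \<delta>(3) by linarith
  qed

  \<comment> \<open>The derivative of decoder after encoder \<open>j\<close> on the range of
    \<open>dD i\<close>\<close>
  obtain F :: "real^'d \<Rightarrow> real^'n" where F: "linear F" "inj F" "range F \<subseteq> tangent_space M x"
    using tangent_frame[OF M] x(1) chart(1)[OF I(1)] by blast
  have comp: "frechet_derivative (dec (A l) \<circ> enc (A l)) (at x) v = dD l (enc (A l) x) (dE l x v)"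
    if "l \<in> {i, j}" for l v
    unfolding dD_def dE_def using that I xn chart(8,9) by (auto simp: frechet_derivative_compose)
  have defect: "norm (dD l (enc (A l) x) (dE l x (F s)) - F s) \<le> \<eta> * norm (F s)" if "l \<in> {i, j}" for l s
  proof -
    have "norm (dD l (enc (A l) x) (dE l x (F s)) - F s) \<le> eta1 M (A l) * norm (F s)"
      unfolding comp[OF that, symmetric]
      using that I x xn F(3) by (intro norm_tangent_defect_le_eta1 chart(11) differentiable_chain_at chart(8,9)) auto
    also have "\<dots> \<le> \<eta> * norm (F s)"
      using that by (intro mult_right_mono) (auto simp: \<eta>_def eta3_def)
    finally show ?thesis .
  qed
  \<comment> \<open>\<open>F\<close> is injective, so a nonzero tangent vector exists, and the
    defect bound there forces the sign of \<open>\<eta>\<close>.\<close>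
  have \<eta>: "\<eta> \<ge> 0"
  proof -
    have "F (axis undefined 1) \<noteq> F 0" using F(2) by (metis axis_eq_0_iff inj_eq zero_neq_one)
    then have "norm (F (axis undefined 1)) > 0" using F(1) by (simp add: linear_0)
    moreover have "0 \<le> \<eta> * norm (F (axis undefined 1))"
      using defect[of i] by (meson insertI1 norm_ge_zero order_trans)
    ultimately show ?thesis by (simp add: zero_le_mult_iff)
  qed
  have eff: "eff \<ge> 0"
    using \<eta> small'(1) LD L L' Dnn D'nn \<epsilon> by (auto simp: eff_def eta_eff_def intro!: add_nonneg_nonneg)

  \<comment> \<open>The vector \<open>r\<close> is only near the tangent space. It is compared with
    a tangent vector \<open>v\<close>, to which the defect bound of chart \<open>j\<close> applies
    at \<open>x\<close>; then the base points are moved to \<open>y\<close> and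
    \<open>w\<close>.\<close>
  have key: "norm (dD j w (dE j y r) - r) \<le> eff * norm r" if r: "r = dD i (enc (A i) x) u" for r u
  proof -
    obtain s where s: "dD i (enc (A i) x) (dE i x (F s)) = r" "norm (F s) \<le> norm r / (1 - \<eta>)"
      unfolding r
    proof (rule decoder_range_tangent)
      show "linear (dD i (enc (A i) x))" "linear (dE i x)"
        using linE[OF I(1) xn(1)] linD[OF I(1) xn(1)] by (simp_all add: bounded_linear.linear)
      show "norm (dD i (enc (A i) x) (dE i x (F s)) - F s) \<le> \<eta> * norm (F s)" for s
        by (rule defect) simp
    qed (use F small'(1) in auto)
    define v where "v = F s"
    have rv: "norm (r - v) \<le> \<eta> * norm v" using defect[of i s] s by (simp add: v_def)
    define Q where "Q = (\<lambda>v. dD j (enc (A j) x) (dE j x v))"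
    have linQ: "linear Q"
      using linear_compose[OF bounded_linear.linear[OF linE[OF I(2) xn(2)]]
          bounded_linear.linear[OF linD[OF I(2) xn(2)]]]
      by (simp add: Q_def comp_def)
    have "norm (Q (r - v)) \<le> D * norm (dE j x (r - v))" unfolding Q_def using xn by (intro D) auto
    also have "\<dots> \<le> D * (L * norm (r - v))" using Dnn xn by (intro mult_left_mono E) auto
    finally have Qrv: "norm (Q (r - v)) \<le> L * D * norm (r - v)" by (simp add: ac_simps)
    \<comment> \<open>The three terms contribute \<open>\<eta>\<close>,
      \<open>L * D * \<eta>\<close> and \<open>\<eta>\<close>, each times \<open>norm v\<close>;
      hence the factor \<open>L * D + 2\<close> in \<open>eta_eff\<close>.\<close>
    have Qr_eq: "Q r - r = (Q v - v) + Q (r - v) - (r - v)" using linQ by (simp add: linear_diff)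
    have "norm (Q r - r) \<le> norm (Q v - v) + norm (Q (r - v)) + norm (r - v)"
      unfolding Qr_eq by (rule order.trans[OF norm_triangle_ineq4 add_right_mono[OF norm_triangle_ineq]])
    also have "\<dots> \<le> \<eta> * norm v + L * D * norm (r - v) + norm (r - v)"
      using defect[of j s] Qrv by (simp add: Q_def v_def)
    also have "\<dots> \<le> \<eta> * norm v + L * D * (\<eta> * norm v) + \<eta> * norm v"
      by (intro add_mono order.refl rv mult_left_mono[OF rv LD])
    also have "\<dots> = (L * D + 2) * \<eta> * norm v" by (simp add: algebra_simps)
    also have "\<dots> \<le> (L * D + 2) * \<eta> * (norm r / (1 - \<eta>))"
      using s(2) \<eta> LD by (intro mult_left_mono) (auto simp: v_def)
    finally have Qr: "norm (Q r - r) \<le> (L * D + 2) * \<eta> / (1 - \<eta>) * norm r" by simp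

    \<comment> \<open>Moving the base point of \<open>dD j\<close>, then that of
      \<open>dE j\<close>, produces the two terms of \<open>eta_eff\<close> that carry
      \<open>\<epsilon>\<close>.\<close>
    have "norm (dD j w (dE j y r) - dD j (enc (A j) x) (dE j y r))
        \<le> D' * norm (w - enc (A j) x) * norm (dE j y r)"
      unfolding w_def using xn yn by (intro D') auto
    also have "\<dots> \<le> D' * (L * \<epsilon>) * (L * norm r)"
      by (rule mult_mono[OF mult_left_mono[OF wz D'nn] E]) (use D'nn L \<epsilon> yn in auto)
    finally have 1: "norm (dD j w (dE j y r) - dD j (enc (A j) x) (dE j y r)) \<le> D' * (L * \<epsilon>) * (L * norm r)" .
    have "norm (dD j (enc (A j) x) (dE j y r - dE j x r)) \<le> D * norm (dE j y r - dE j x r)"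
      using xn by (intro D) auto
    also have "\<dots> \<le> D * (L' * norm (y - x) * norm r)"
      using Dnn xn yn by (intro mult_left_mono E') auto
    also have "\<dots> \<le> D * (L' * \<epsilon> * norm r)"
      using Dnn L' y by (intro mult_left_mono mult_right_mono) auto
    finally have 2: "norm (dD j (enc (A j) x) (dE j y r - dE j x r)) \<le> D * (L' * \<epsilon> * norm r)" .
    have S_eq: "dD j w (dE j y r) - r = (dD j w (dE j y r) - dD j (enc (A j) x) (dE j y r))
        + dD j (enc (A j) x) (dE j y r - dE j x r) + (Q r - r)"
      using linD[OF I(2) xn(2)] by (simp add: Q_def linear_diff bounded_linear.linear)
    have "norm (dD j w (dE j y r) - r) \<le> norm (dD j w (dE j y r) - dD j (enc (A j) x) (dE j y r))
        + norm (dD j (enc (A j) x) (dE j y r - dE j x r)) + norm (Q r - r)"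
      unfolding S_eq by (rule order.trans[OF norm_triangle_ineq add_right_mono[OF norm_triangle_ineq]])
    also have "\<dots> \<le> D' * (L * \<epsilon>) * (L * norm r) + D * (L' * \<epsilon> * norm r) + (L * D + 2) * \<eta> / (1 - \<eta>) * norm r"
      by (intro add_mono 1 2 Qr)
    also have "\<dots> = eff * norm r"
      by (simp add: eff_def eta_eff_def algebra_simps power2_eq_square)
    finally show ?thesis .
  qed

  \<comment> \<open>Comparison of the product with the direct Jacobian\<close>
  have "sgn (det (H ** trans_jac A j i x)) = sgn (det (trans_jac A k i x))"
  proof (rule sgn_det_perturbation[where L="L * D" and G=\<Gamma>])
    show "norm (trans_jac A k i x *v u) \<le> L * D * norm u" for u
    proof -
      have "norm (dE k y (dD i (enc (A i) x) u)) \<le> L * norm (dD i (enc (A i) x) u)"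
        using yn by (intro E) auto
      also have "\<dots> \<le> L * (D * norm u)" using L xn by (intro mult_left_mono D) auto
      finally show ?thesis by (simp add: Gki mult.assoc)
    qed
    show "norm (trans_jac A k i x *v u - (H ** trans_jac A j i x) *v u) \<le> \<Gamma> * norm u" for u
    proof -
      define r where "r = dD i (enc (A i) x) u"
      define t where "t = dD j w (dE j y r)"
      have tr: "norm (t - r) \<le> eff * norm r" unfolding t_def by (rule key[OF r_def])
      have t: "norm t \<le> (1 + eff) * norm r"
        using tr norm_triangle_ineq[of "t - r" r] by (simp add: algebra_simps)
      have r: "norm r \<le> D * norm u" unfolding r_def using xn by (intro D) auto
      \<comment> \<open>The same splitting as for \<open>H\<close> gives the two summands of
        \<open>Gamma3\<close>; their common factor \<open>D\<close> comes from bounding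
        \<open>r\<close>.\<close>
      have "dE k y r - dE k q t = dE k y (r - t) + (dE k y t - dE k q t)"
        using linE[OF I(3) yn(1)] by (simp add: linear_diff bounded_linear.linear)
      then have "norm (dE k y r - dE k q t) \<le> norm (dE k y (r - t)) + norm (dE k y t - dE k q t)"
        by (simp only: norm_triangle_ineq)
      also have "\<dots> \<le> L * norm (r - t) + L' * norm (y - q) * norm t"
        using yn qn by (intro add_mono E E') auto
      also have "\<dots> \<le> L * (eff * norm r) + L' * ((L * D + 2) * \<epsilon>) * ((1 + eff) * norm r)"
        using L L' LD \<epsilon> tr yq t
        by (intro add_mono mult_left_mono mult_mono) (auto simp: norm_minus_commute)
      also have "\<dots> = (L * eff + L' * ((L * D + 2) * \<epsilon>) * (1 + eff)) * norm r"
        by (simp add: algebra_simps)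
      also have "\<dots> \<le> (L * eff + L' * ((L * D + 2) * \<epsilon>) * (1 + eff)) * (D * norm u)"
        using L L' LD \<epsilon> eff r by (intro mult_left_mono) auto
      also have "\<dots> = \<Gamma> * norm u"
        by (simp add: \<Gamma>_def Gamma3_def eff_def algebra_simps)
      finally show ?thesis
        by (simp add: Gki Gji H matrix_vector_mul_assoc[symmetric] r_def t_def)
    qed
    show "real CARD('d) * \<Gamma> * (L * D + \<Gamma>) ^ (CARD('d) - 1) < \<bar>det (trans_jac A k i x)\<bar>"
      using small'(3) \<delta>(2) by linarith
  qed
  then show ?thesis
    by (simp add: omega_def det_mul sgn_mult sgnH)
qed

subsection \<open>The Cech class\<close>

text \<open>By the chain rule each entry is a finite sum of products of directional derivatives,
  which are continuous for \<open>C^1\<close> maps, evaluated at continuous functions of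
  \<open>x\<close>.\<close>

lemma continuous_on_trans_jac:
  fixes M :: "(real^'n::finite) set" and A :: "'i \<Rightarrow> ('n, 'd::finite) ae_chart"
  assumes atlas: "approx_ae_atlas M I A \<epsilon> \<eta>" and I: "i \<in> I" "j \<in> I"
  shows "continuous_on (patch (A i) \<inter> patch (A j)) (\<lambda>x. trans_jac A j i x $ a $ b)"
proof -
  note chart = approx_ae_atlasD[OF atlas]
  let ?S = "patch (A i) \<inter> patch (A j)" and ?y = "\<lambda>x. dec (A i) (enc (A i) x)"
  obtain R where R: "R \<ge> 1" "enlarged_nbhds I A \<epsilon> R"
    using atlas unfolding approx_ae_atlas_def by blast
  \<comment> \<open>The reconstruction error is at most \<open>\<epsilon>\<close>, so
    \<open>R \<ge> 1\<close> suffices here.\<close>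
  have yn: "?y x \<in> nbhd (A j)" if "x \<in> ?S" for x
  proof (rule enlarged_nbhdsD[OF R(2) I(2)])
    have y: "norm (?y x - x) \<le> \<epsilon>" using chart(10) I that by blast
    then have "0 \<le> \<epsilon>" by (rule order.trans[OF norm_ge_zero])
    from mult_right_mono[OF R(1) this] y show "norm (?y x - x) \<le> R * \<epsilon>" by linarith
  qed (use that in auto)
  have xn: "x \<in> nbhd (A i)" if "x \<in> ?S" for x using chart(3) I that by blast
  have enc: "continuous_on ?S (enc (A i))"
    using chart(8)[OF I(1) xn] by (intro continuous_at_imp_continuous_on ballI differentiable_imp_continuous_within)
  have y: "continuous_on ?S ?y"
  proof (rule continuous_on_compose2[OF _ enc])
    show "continuous_on (latent (A i)) (dec (A i))"
      using chart(7)[OF I(1)]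
      by (intro continuous_at_imp_continuous_on ballI differentiable_imp_continuous_within) simp
  qed (use xn chart(5)[OF I(1)] in auto)
  have dE: "continuous_on ?S (\<lambda>x. frechet_derivative (enc (A j)) (at (?y x)) v)" for v
  proof (rule continuous_on_compose2[OF _ y])
    show "continuous_on (nbhd (A j)) (\<lambda>p. frechet_derivative (enc (A j)) (at p) v)"
      using chart(6)[OF I(2)] by simp
  qed (use yn in auto)
  have dD: "continuous_on ?S (\<lambda>x. frechet_derivative (dec (A i)) (at (enc (A i) x)) v)" for v
  proof (rule continuous_on_compose2[OF _ enc])
    show "continuous_on (latent (A i)) (\<lambda>z. frechet_derivative (dec (A i)) (at z) v)"
      using chart(7)[OF I(1)] by simp
  qed (use xn chart(5)[OF I(1)] in auto)
  have "trans_jac A j i x = matrix (frechet_derivative (enc (A j)) (at (?y x))) **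
      matrix (frechet_derivative (dec (A i)) (at (enc (A i) x)))" if "x \<in> ?S" for x
  proof -
    have d: "dec (A i) differentiable at (enc (A i) x)" "enc (A j) differentiable at (?y x)"
      using chart(9)[OF I(1) xn[OF that]] chart(8)[OF I(2) yn[OF that]] by auto
    show ?thesis
      by (simp add: transition_derivative d matrix_compose linear_frechet_derivative)
  qed
  then have entry: "trans_jac A j i x $ a $ b =
      (\<Sum>m\<in>UNIV. frechet_derivative (enc (A j)) (at (?y x)) (axis m 1) $ a *
        frechet_derivative (dec (A i)) (at (enc (A i) x)) (axis b 1) $ m)" if "x \<in> ?S" for x
    using that by (simp add: matrix_matrix_mult_def matrix_def)
  have "continuous_on ?S (\<lambda>x. \<Sum>m\<in>UNIV.
      frechet_derivative (enc (A j)) (at (?y x)) (axis m 1) $ a *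
      frechet_derivative (dec (A i)) (at (enc (A i) x)) (axis b 1) $ m)"
    by (intro continuous_intros dE dD)
  then show ?thesis by (subst continuous_on_cong[OF refl entry])
qed

text \<open>By continuity \<open>f y * f x\<close> is positive for \<open>y\<close> near
  \<open>x\<close>, so the sign does not change there.\<close>

lemma sign_function_on_sgn:
  fixes f :: "'a::topological_space \<Rightarrow> real"
  assumes "continuous_on S f" "\<And>x. x \<in> S \<Longrightarrow> f x \<noteq> 0"
  shows "sign_function_on S (\<lambda>x. sgn (f x))"
  unfolding sign_function_on_def locally_constant_on_def
proof (intro conjI ballI)
  show "(\<lambda>x. sgn (f x)) ` S \<subseteq> {1, -1}" using assms(2) by (auto simp: sgn_if)
  fix x assume x: "x \<in> S"
  define V where "V = S \<inter> (\<lambda>y. f y * f x) -` {0<..}"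
  have "openin (top_of_set S) V"
    unfolding V_def by (intro continuous_openin_preimage_gen continuous_intros assms(1))
  moreover have "x \<in> V" using x assms(2)[OF x] by (auto simp: V_def zero_less_mult_iff)
  moreover have "(\<lambda>x. sgn (f x)) constant_on V"
    unfolding constant_on_def by (rule exI[of _ "sgn (f x)"]) (auto simp: V_def zero_less_mult_iff)
  ultimately show "\<exists>V. openin (top_of_set S) V \<and> x \<in> V \<and> (\<lambda>x. sgn (f x)) constant_on V"
    by blast
qed

lemma cech_class_in_H1:
  assumes "linear_order_on I r" "c \<in> cech_cocycles I r U"
  shows "cech_class I r U c \<in> carrier (cech_H1 I r U)"
proof -
  interpret comm_group "cech_Z1 I r U" by (rule comm_group_cech_Z1)
  show ?thesis
    unfolding cech_class_def cech_H1_def FactGroup_def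
    using rcosetsI[OF subgroup.subset[OF subgroup_cech_coboundaries[OF assms(1)]]] assms(2)
    by (simp add: cech_Z1_def)
qed

text \<open>Because of the swapped indices in \<open>omega_cech\<close>, \<open>triple\<close> is
  the cocycle identity up to the order of the factors.\<close>

lemma omega_cech_in_cocycles:
  fixes M :: "(real^'n::finite) set" and A :: "'i \<Rightarrow> ('n, 'd::finite) ae_chart"
  assumes atlas: "approx_ae_atlas M I A \<epsilon> \<eta>"
    and r: "linear_order_on I r" and dets: "dets_bounded_away I r A"
    and triple: "\<And>\<alpha> \<beta> \<gamma> x. index_less I r \<alpha> \<beta> \<Longrightarrow> index_less I r \<beta> \<gamma> \<Longrightarrow>
      x \<in> patch (A \<alpha>) \<inter> patch (A \<beta>) \<inter> patch (A \<gamma>) \<Longrightarrow> omega A \<gamma> \<alpha> x = omega A \<gamma> \<beta> x * omega A \<beta> \<alpha> x"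
  shows "omega_cech I r A \<in> cech_cocycles I r (\<lambda>i. patch (A i))"
proof -
  \<comment> \<open>Antisymmetry gives \<open>\<alpha> \<noteq> \<gamma>\<close>; otherwise
    normalisation would put the default \<open>1\<close> at this pair.\<close>
  have less_trans: "index_less I r \<alpha> \<gamma>" if "index_less I r \<alpha> \<beta>" "index_less I r \<beta> \<gamma>" for \<alpha> \<beta> \<gamma>
    using that r unfolding index_less_def order_on_defs by (blast dest: antisymD transD)
  have "sign_function_on (patch (A \<alpha>) \<inter> patch (A \<beta>)) (omega_cech I r A \<alpha> \<beta>)"
    if less: "index_less I r \<alpha> \<beta>" for \<alpha> \<beta>
  proof (rule sign_function_on_cong)
    have "\<alpha> \<in> I" "\<beta> \<in> I" using less unfolding index_less_def by auto
    \<comment> \<open>All double overlaps matter, also away from triple ones, so nonvanishing comes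
      from \<open>dets_bounded_away\<close> and not from \<open>delta3\<close>.\<close>
    moreover have "det (trans_jac A \<beta> \<alpha> x) \<noteq> 0" if "x \<in> patch (A \<alpha>) \<inter> patch (A \<beta>)" for x
    proof -
      obtain c where "c > 0" and c: "\<forall>\<alpha> \<beta>. index_less I r \<alpha> \<beta> \<longrightarrow>
          (\<forall>x\<in>patch (A \<alpha>) \<inter> patch (A \<beta>). c \<le> \<bar>det (trans_jac A \<beta> \<alpha> x)\<bar>)"
        using dets unfolding dets_bounded_away_def by (elim exE conjE)
      then show ?thesis using c[rule_format, OF less that] by auto
    qed
    ultimately show "sign_function_on (patch (A \<alpha>) \<inter> patch (A \<beta>)) (\<lambda>x. sgn (det (trans_jac A \<beta> \<alpha> x)))"
      using continuous_on_trans_jac[OF atlas]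
      by (intro sign_function_on_sgn continuous_on_det) auto
    show "sgn (det (trans_jac A \<beta> \<alpha> x)) = omega_cech I r A \<alpha> \<beta> x"
      if "x \<in> patch (A \<alpha>) \<inter> patch (A \<beta>)" for x
      using that less by (simp add: omega_cech_def cech_normalize_def omega_def)
  qed
  moreover have "omega_cech I r A \<alpha> \<gamma> x = omega_cech I r A \<alpha> \<beta> x * omega_cech I r A \<beta> \<gamma> x"
    if "index_less I r \<alpha> \<beta>" "index_less I r \<beta> \<gamma>"
      and "x \<in> patch (A \<alpha>) \<inter> patch (A \<beta>) \<inter> patch (A \<gamma>)" for \<alpha> \<beta> \<gamma> x
    using triple[OF that] that less_trans[OF that(1,2)]
    by (simp add: omega_cech_def cech_normalize_def)
  moreover have "cech_normalize I r (\<lambda>i. patch (A i)) (omega_cech I r A) = omega_cech I r A"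
    by (simp add: omega_cech_def cech_normalize_def fun_eq_iff)
  ultimately show ?thesis unfolding cech_cocycles_def by blast
qed

theorem theorem4p12:
  fixes M :: "(real^'n::finite) set"
    and I :: "'i set"
    and A :: "'i \<Rightarrow> ('n, 'd::finite) ae_chart"
    and \<epsilon> :: real
  assumes "compact M"
    and "smooth_submanifold TYPE('d) M"
    and "\<exists>\<eta>. approx_ae_atlas M I A \<epsilon> \<eta>"
  shows
    "(\<forall>i\<in>I. \<forall>j\<in>I. \<forall>k\<in>I. \<forall>L\<^sub>E L\<^sub>E' L\<^sub>D L\<^sub>D'.
        patch (A i) \<inter> patch (A j) \<inter> patch (A k) \<noteq> {} \<longrightarrow>
        triple_bounds M A \<epsilon> i j k L\<^sub>E L\<^sub>E' L\<^sub>D L\<^sub>D' \<longrightarrow>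
        enlarged_nbhds I A \<epsilon> (L\<^sub>E * L\<^sub>D + 3) \<longrightarrow>
        triple_small M A \<epsilon> i j k L\<^sub>E L\<^sub>E' L\<^sub>D L\<^sub>D' \<longrightarrow>
        (\<forall>x \<in> patch (A i) \<inter> patch (A j) \<inter> patch (A k).
           omega A k i x = omega A k j x * omega A j i x)) \<and>
     (\<forall>r. linear_order_on I r \<longrightarrow>
        dets_bounded_away I r A \<longrightarrow>
        (\<forall>\<alpha> \<beta> \<gamma>. index_less I r \<alpha> \<beta> \<longrightarrow> index_less I r \<beta> \<gamma> \<longrightarrow>
           patch (A \<alpha>) \<inter> patch (A \<beta>) \<inter> patch (A \<gamma>) \<noteq> {} \<longrightarrow>
           (\<exists>L\<^sub>E L\<^sub>E' L\<^sub>D L\<^sub>D'.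
              triple_bounds M A \<epsilon> \<alpha> \<beta> \<gamma> L\<^sub>E L\<^sub>E' L\<^sub>D L\<^sub>D' \<and>
              enlarged_nbhds I A \<epsilon> (L\<^sub>E * L\<^sub>D + 3) \<and>
              triple_small M A \<epsilon> \<alpha> \<beta> \<gamma> L\<^sub>E L\<^sub>E' L\<^sub>D L\<^sub>D')) \<longrightarrow>
        omega_cech I r A \<in> cech_cocycles I r (\<lambda>i. patch (A i)) \<and>
        cech_class I r (\<lambda>i. patch (A i)) (omega_cech I r A)
          \<in> carrier (cech_H1 I r (\<lambda>i. patch (A i))))"
proof -
  obtain \<eta> where atlas: "approx_ae_atlas M I A \<epsilon> \<eta>" using assms(3) by blast
  note triple = omega_triple[OF assms(2) atlas]
  show ?thesis
  proof (intro conjI allI impI ballI)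
    fix i j k L\<^sub>E L\<^sub>E' L\<^sub>D L\<^sub>D' x
    assume "i \<in> I" "j \<in> I" "k \<in> I" "triple_bounds M A \<epsilon> i j k L\<^sub>E L\<^sub>E' L\<^sub>D L\<^sub>D'"
      "enlarged_nbhds I A \<epsilon> (L\<^sub>E * L\<^sub>D + 3)" "triple_small M A \<epsilon> i j k L\<^sub>E L\<^sub>E' L\<^sub>D L\<^sub>D'"
      "x \<in> patch (A i) \<inter> patch (A j) \<inter> patch (A k)"
    then show "omega A k i x = omega A k j x * omega A j i x" by (intro triple) auto
  next
    fix r
    assume r: "linear_order_on I r" and dets: "dets_bounded_away I r A"
      and *: "\<forall>\<alpha> \<beta> \<gamma>. index_less I r \<alpha> \<beta> \<longrightarrow> index_less I r \<beta> \<gamma> \<longrightarrow>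
           patch (A \<alpha>) \<inter> patch (A \<beta>) \<inter> patch (A \<gamma>) \<noteq> {} \<longrightarrow>
           (\<exists>L\<^sub>E L\<^sub>E' L\<^sub>D L\<^sub>D'.
              triple_bounds M A \<epsilon> \<alpha> \<beta> \<gamma> L\<^sub>E L\<^sub>E' L\<^sub>D L\<^sub>D' \<and>
              enlarged_nbhds I A \<epsilon> (L\<^sub>E * L\<^sub>D + 3) \<and>
              triple_small M A \<epsilon> \<alpha> \<beta> \<gamma> L\<^sub>E L\<^sub>E' L\<^sub>D L\<^sub>D')"
    show cocycle: "omega_cech I r A \<in> cech_cocycles I r (\<lambda>i. patch (A i))"
    proof (rule omega_cech_in_cocycles[OF atlas r dets])
      fix \<alpha> \<beta> \<gamma> x
      assume less: "index_less I r \<alpha> \<beta>" "index_less I r \<beta> \<gamma>"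
        and x: "x \<in> patch (A \<alpha>) \<inter> patch (A \<beta>) \<inter> patch (A \<gamma>)"
      \<comment> \<open>The point \<open>x\<close> shows that the triple overlap is nonempty, which
        yields constants for this triple.\<close>
      then obtain L\<^sub>E L\<^sub>E' L\<^sub>D L\<^sub>D' where
        "triple_bounds M A \<epsilon> \<alpha> \<beta> \<gamma> L\<^sub>E L\<^sub>E' L\<^sub>D L\<^sub>D'" "enlarged_nbhds I A \<epsilon> (L\<^sub>E * L\<^sub>D + 3)"
        "triple_small M A \<epsilon> \<alpha> \<beta> \<gamma> L\<^sub>E L\<^sub>E' L\<^sub>D L\<^sub>D'"
        using * by blast
      then show "omega A \<gamma> \<alpha> x = omega A \<gamma> \<beta> x * omega A \<beta> \<alpha> x"
        using less x by (intro triple) (auto simp: index_less_def)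
    qed
    show "cech_class I r (\<lambda>i. patch (A i)) (omega_cech I r A)
        \<in> carrier (cech_H1 I r (\<lambda>i. patch (A i)))"
      by (rule cech_class_in_H1[OF r cocycle])
  qed
qed

end
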